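(* Let $n\ge2$ and let $\underline S=(S_1,\dots,S_n)$ be an Agler-Young tuple (Agler-Young contraction) on a Hilbert space $\mathcal H$, with fundamental operator tuple $\boldsymbol X=(X_1,\dots,X_{n-1})$, $X_i\in\mathcal B(\mathcal D_{S_n})$. Let $\mathcal K_0=\mathcal H\oplus\mathcal D_{S_n}\oplus\mathcal D_{S_n}\oplus\cdots=\mathcal H\oplus\ell^2(\mathcal D_{S_n})$, and define operators on $\mathcal K_0$ by $$V_i^{\boldsymbol X}(h_0,h_1,h_2,\dots)=(S_ih_0,\;X_{n-i}^*D_{S_n}h_0+X_ih_1,\;X_{n-i}^*h_1+X_ih_2,\;X_{n-i}^*h_2+X_ih_3,\dots),\quad i=1,\dots,n-1,$$ $$V_n(h_0,h_1,h_2,\dots)=(S_nh_0,\;D_{S_n}h_0,\;h_1,\;h_2,\dots).$$ Put $\underline V^{\boldsymbol X}=(V_1^{\boldsymbol X},\dots,V_{n-1}^{\boldsymbol X},V_n)$ and identify $h\in\mathcal H$ with $(h,0,0,\dots)\in\mathcal K_0$. Then: (1) $\mathcal H$ is a co-invariant subspace of $\underline V^{\boldsymbol X}$, and $\underline V^{\boldsymbol X}$ is an Agler-Young isometric dilation of $\underline S$. (2) If $(W_1,\dots,W_{n-1},V_n)$ is any Agler-Young isometric dilation of $\underline S$ on $\mathcal K_0$ (with last entry the operator $V_n(h_0,h_1,h_2,\dots)=(S_nh_0,D_{S_n}h_0,h_1,h_2,\dots)$) for which $\mathcal H$ is a co-invariant subspace, then $W_i=V_i^{\boldsymbol X}$ for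 $i=1,\dots,n-1$. (3) If $(W_1,\dots,W_n)$ is an Agler-Young isometric dilation of $\underline S$, where $W_n$ is a minimal isometric dilation of $S_n$, then $(W_1,\dots,W_n)$ is unitarily equivalent to $(V_1^{\boldsymbol X},\dots,V_{n-1}^{\boldsymbol X},V_n)$.
   Context: For a contraction $T$, $D_T=(I-T^*T)^{1/2}$ and $\mathcal D_T=\overline{\mathrm{Ran}}\,D_T$. A tuple $\underline S=(S_1,\dots,S_n)$ of bounded operators on $\mathcal H$ (not assumed to commute) is an Agler-Young tuple (also called an Agler-Young contraction, or a member of $AY_n$) if $S_n$ is a contraction and there are $X_i\in\mathcal B(\mathcal D_{S_n})$ with $S_i-S_{n-i}^*S_n=D_{S_n}X_iD_{S_n}$ for $i=1,\dots,n-1$; these $X_i$ are unique and $(X_1,\dots,X_{n-1})$ is the fundamental operator tuple of $\underline S$. It is an Agler-Young isometry if $S_n$ is an isometry and $S_i=S_{n-i}^*S_n$ for $i=1,\dots,n-1$. If $\mathcal H\subset\mathcal K$, a tuple $\underline V=(V_1,\dots,V_n)$ on $\mathcal K$ is a dilation of $\underline S=(S_1,\dots,S_n)$ on $\mathcal H$ if $S_{i_1}\cdots S_{i_k}h=P_{\mathcal H}V_{i_1}\cdots V_{i_k}h$ for all $h\in\mathcal H$, $k\ge1$, $1\le i_1,\dots,i_k\le n$; it is an Agler-Young isometric dilation if $\underline V$ is an Agler-Young isometry. $\mathcal H$ is co-invariant for $\underline V$ if it is invariant under each $V_i^*$. Unitary equivalence of tuples means simultaneous conjugation by one unitary. A minimal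 isometric dilation of a single contraction $A$ on $\mathcal H$ is an isometry $W$ on $\mathcal K\supset\mathcal H$ dilating $A$ with $\mathcal K=\overline{\mathrm{span}}\{W^mh:h\in\mathcal H,m\ge0\}$. *)

theory Defs
  imports "HOL-Analysis.Analysis"
begin

section \<open>Complex Hilbert spaces\<close>

text \<open>The norm, metric and topology are those of the underlying real inner product space, whose
  inner product is the real part of \<open>cinner\<close>. The form \<open>cinner\<close> is linear in its first argument.\<close>

class complex_inner = real_inner +
  fixes scaleC :: "complex \<Rightarrow> 'a \<Rightarrow> 'a" (infixr "*\<^sub>C" 75)
    and cinner :: "'a \<Rightarrow> 'a \<Rightarrow> complex"
  assumes scaleC_add_right: "a *\<^sub>C (x + y) = a *\<^sub>C x + a *\<^sub>C y"
    and scaleC_add_left: "(a + b) *\<^sub>C x = a *\<^sub>C x + b *\<^sub>C x"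
    and scaleC_scaleC: "a *\<^sub>C b *\<^sub>C x = (a * b) *\<^sub>C x"
    and scaleC_of_real: "complex_of_real r *\<^sub>C x = r *\<^sub>R x"
    and cinner_commute: "cinner x y = cnj (cinner y x)"
    and cinner_add_left: "cinner (x + y) z = cinner x z + cinner y z"
    and cinner_scaleC_left: "cinner (a *\<^sub>C x) y = a * cinner x y"
    and Re_cinner: "Re (cinner x y) = inner x y"

class chilbert_space = complex_inner + complete_space

global_interpretation cvec: vector_space "scaleC :: complex \<Rightarrow> 'a \<Rightarrow> 'a::complex_inner"
  defines csubspace = cvec.subspace and cspan = cvec.span
  using scaleC_of_real[where r = 1]
  by unfold_locales (simp_all add: scaleC_add_right scaleC_add_left scaleC_scaleC)

lemma Im_cinner: "Im (cinner x y) = - inner (\<i> *\<^sub>C x) (y::'a::complex_inner)"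
  by (simp add: Re_cinner[symmetric] cinner_scaleC_left)

lemma norm_iscale: "norm (\<i> *\<^sub>C (x::'a::complex_inner)) = norm x"
proof -
  have "cinner (\<i> *\<^sub>C x) (\<i> *\<^sub>C x) = \<i> * cnj (cinner (\<i> *\<^sub>C x) x)"
    by (subst cinner_scaleC_left) (simp add: cinner_commute[of x "\<i> *\<^sub>C x"])
  also have "\<dots> = cnj (cinner x x)"
    by (simp add: cinner_scaleC_left)
  finally have "inner (\<i> *\<^sub>C x) (\<i> *\<^sub>C x) = inner x x"
    by (simp add: Re_cinner[symmetric])
  then show ?thesis by (simp add: norm_eq_sqrt_inner)
qed

lemma norm_cinner_le: "norm (cinner x (y::'a::complex_inner)) \<le> 2 * (norm x * norm y)"
proof -
  have "\<bar>Re (cinner x y)\<bar> \<le> norm x * norm y"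
    unfolding Re_cinner by (rule Cauchy_Schwarz_ineq2)
  moreover have "\<bar>Im (cinner x y)\<bar> \<le> norm x * norm y"
    using Cauchy_Schwarz_ineq2[of "\<i> *\<^sub>C x" y] unfolding Im_cinner norm_iscale by simp
  ultimately show ?thesis using cmod_le[of "cinner x y"] by linarith
qed

lemma norm_scaleC: "norm (a *\<^sub>C (x::'a::complex_inner)) = norm a * norm x"
proof -
  have "cinner (a *\<^sub>C x) (a *\<^sub>C x) = a * cnj (cinner (a *\<^sub>C x) x)"
    by (subst cinner_scaleC_left) (simp add: cinner_commute[of x "a *\<^sub>C x"])
  also have "\<dots> = of_real ((norm a)\<^sup>2) * cnj (cinner x x)"
    by (simp only: cinner_scaleC_left complex_cnj_mult mult.assoc[symmetric] complex_norm_square)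
  finally have "inner (a *\<^sub>C x) (a *\<^sub>C x) = (norm a)\<^sup>2 * inner x x"
    by (simp add: Re_cinner[symmetric])
  then show ?thesis by (simp add: norm_eq_sqrt_inner real_sqrt_mult)
qed

instantiation complex :: chilbert_space
begin

definition scaleC_complex :: "complex \<Rightarrow> complex \<Rightarrow> complex" where
  "scaleC_complex a x = a * x"
definition cinner_complex :: "complex \<Rightarrow> complex \<Rightarrow> complex" where
  "cinner_complex x y = x * cnj y"

instance
  by standard (simp_all add: scaleC_complex_def cinner_complex_def algebra_simps
      scaleR_conv_of_real inner_complex_def)

end

section \<open>Square-summable sequences\<close>

typedef (overloaded) ('a::complex_inner) ell2 =
  "{f :: nat \<Rightarrow> 'a. summable (\<lambda>k. (norm (f k))\<^sup>2)}"
  morphisms ell2_nth Abs_ell2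
  by (rule exI[of _ "\<lambda>_. 0"]) simp

setup_lifting type_definition_ell2

lemma norm_add_sq_le: "(norm (x + y))\<^sup>2 \<le> 2 * (norm (x::'a::real_normed_vector))\<^sup>2 + 2 * (norm y)\<^sup>2"
proof -
  have "(norm (x + y))\<^sup>2 \<le> (norm x + norm y)\<^sup>2"
    by (intro power_mono norm_triangle_ineq) simp
  also have "\<dots> \<le> 2 * (norm x)\<^sup>2 + 2 * (norm y)\<^sup>2"
    using zero_le_power2[of "norm x - norm y"] by (simp add: power2_eq_square algebra_simps)
  finally show ?thesis .
qed

lemma summable_sq_add:
  fixes f g :: "nat \<Rightarrow> 'a::real_normed_vector"
  assumes "summable (\<lambda>k. (norm (f k))\<^sup>2)" "summable (\<lambda>k. (norm (g k))\<^sup>2)"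
  shows "summable (\<lambda>k. (norm (f k + g k))\<^sup>2)"
proof (rule summable_comparison_test_ev)
  show "summable (\<lambda>k. 2 * (norm (f k))\<^sup>2 + 2 * (norm (g k))\<^sup>2)"
    using assms by (intro summable_add summable_mult)
qed (simp add: norm_add_sq_le)

instantiation ell2 :: (complex_inner) complex_inner
begin

lift_definition zero_ell2 :: "'a ell2" is "\<lambda>_. 0" by simp
lift_definition plus_ell2 :: "'a ell2 \<Rightarrow> 'a ell2 \<Rightarrow> 'a ell2" is "\<lambda>f g k. f k + g k"
  by (rule summable_sq_add)
lift_definition uminus_ell2 :: "'a ell2 \<Rightarrow> 'a ell2" is "\<lambda>f k. - f k" by simp
lift_definition minus_ell2 :: "'a ell2 \<Rightarrow> 'a ell2 \<Rightarrow> 'a ell2" is "\<lambda>f g k. f k - g k"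
  using summable_sq_add[of _ "\<lambda>k. - _ k"] by simp
lift_definition scaleR_ell2 :: "real \<Rightarrow> 'a ell2 \<Rightarrow> 'a ell2" is "\<lambda>r f k. r *\<^sub>R f k"
  by (simp add: power_mult_distrib summable_mult)
lift_definition scaleC_ell2 :: "complex \<Rightarrow> 'a ell2 \<Rightarrow> 'a ell2" is "\<lambda>c f k. c *\<^sub>C f k"
  by (simp add: norm_scaleC power_mult_distrib summable_mult)

definition cinner_ell2 :: "'a ell2 \<Rightarrow> 'a ell2 \<Rightarrow> complex" where
  "cinner_ell2 f g = (\<Sum>k. cinner (ell2_nth f k) (ell2_nth g k))"
definition inner_ell2 :: "'a ell2 \<Rightarrow> 'a ell2 \<Rightarrow> real" where
  "inner_ell2 f g = (\<Sum>k. inner (ell2_nth f k) (ell2_nth g k))"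
definition norm_ell2 :: "'a ell2 \<Rightarrow> real" where
  "norm_ell2 f = sqrt (inner f f)"
definition sgn_ell2 :: "'a ell2 \<Rightarrow> 'a ell2" where
  "sgn_ell2 f = inverse (norm f) *\<^sub>R f"
definition dist_ell2 :: "'a ell2 \<Rightarrow> 'a ell2 \<Rightarrow> real" where
  "dist_ell2 f g = norm (f - g)"
definition uniformity_ell2 :: "('a ell2 \<times> 'a ell2) filter" where
  "uniformity_ell2 = (INF e\<in>{0 <..}. principal {(x, y). dist x y < e})"
definition open_ell2 :: "'a ell2 set \<Rightarrow> bool" where
  "open_ell2 U = (\<forall>x\<in>U. eventually (\<lambda>(x', y). x' = x \<longrightarrow> y \<in> U) uniformity)"

lemma summable_ell2: "summable (\<lambda>k. (norm (ell2_nth f k))\<^sup>2)"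
  using ell2_nth[of f] by simp

lemma summable_cinner_ell2: "summable (\<lambda>k. cinner (ell2_nth f k) (ell2_nth g k))"
proof (rule summable_comparison_test_ev)
  have "norm (cinner (ell2_nth f k) (ell2_nth g k))
      \<le> (norm (ell2_nth f k))\<^sup>2 + (norm (ell2_nth g k))\<^sup>2" for k
    using norm_cinner_le[of "ell2_nth f k" "ell2_nth g k"]
      zero_le_power2[of "norm (ell2_nth f k) - norm (ell2_nth g k)"]
    by (simp add: power2_eq_square algebra_simps)
  then show "\<forall>\<^sub>F k in sequentially. norm (cinner (ell2_nth f k) (ell2_nth g k))
      \<le> (norm (ell2_nth f k))\<^sup>2 + (norm (ell2_nth g k))\<^sup>2" by simp
qed (intro summable_add summable_ell2)

lemma summable_inner_ell2: "summable (\<lambda>k. inner (ell2_nth f k) (ell2_nth g k))"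
  using summable_Re[OF summable_cinner_ell2] by (simp add: Re_cinner)

instance
proof
  fix f g h :: "'a ell2" and a b :: real and c d :: complex
  show "dist f g = norm (f - g)" by (rule dist_ell2_def)
  show "sgn f = inverse (norm f) *\<^sub>R f" by (rule sgn_ell2_def)
  show "uniformity = (INF e\<in>{0 <..}. principal {(x, y::'a ell2). dist x y < e})"
    by (rule uniformity_ell2_def)
  show "open U = (\<forall>x\<in>U. \<forall>\<^sub>F (x', y) in uniformity. x' = x \<longrightarrow> y \<in> U)" for U :: "'a ell2 set"
    by (rule open_ell2_def)
  show "f + g + h = f + (g + h)" by transfer (simp add: add.assoc)
  show "f + g = g + f" by transfer (simp add: add.commute)
  show "0 + f = f" by transfer simp
  show "- f + f = 0" by transfer simp
  show "f - g = f + - g" by transfer simp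
  show "a *\<^sub>R (f + g) = a *\<^sub>R f + a *\<^sub>R g" by transfer (simp add: scaleR_add_right)
  show "(a + b) *\<^sub>R f = a *\<^sub>R f + b *\<^sub>R f" by transfer (simp add: scaleR_add_left)
  show "a *\<^sub>R b *\<^sub>R f = (a * b) *\<^sub>R f" by transfer simp
  show "1 *\<^sub>R f = f" by transfer simp
  show "inner f g = inner g f" by (simp add: inner_ell2_def inner_commute)
  show "inner (f + g) h = inner f h + inner g h"
    by (simp add: inner_ell2_def plus_ell2.rep_eq inner_add_left suminf_add summable_inner_ell2)
  show "inner (a *\<^sub>R f) g = a * inner f g"
    by (simp add: inner_ell2_def scaleR_ell2.rep_eq suminf_mult summable_inner_ell2)
  show "0 \<le> inner f f"
    by (simp add: inner_ell2_def suminf_nonneg summable_inner_ell2)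
  show "(inner f f = 0) = (f = 0)"
    by (simp add: inner_ell2_def suminf_eq_zero_iff summable_inner_ell2 ell2_nth_inject[symmetric]
        zero_ell2.rep_eq fun_eq_iff)
  show "norm f = sqrt (inner f f)" by (rule norm_ell2_def)
  show "c *\<^sub>C (f + g) = c *\<^sub>C f + c *\<^sub>C g" by transfer (simp add: scaleC_add_right)
  show "(c + d) *\<^sub>C f = c *\<^sub>C f + d *\<^sub>C f" by transfer (simp add: scaleC_add_left)
  show "c *\<^sub>C d *\<^sub>C f = (c * d) *\<^sub>C f" by transfer (simp add: scaleC_scaleC)
  show "complex_of_real a *\<^sub>C f = a *\<^sub>R f" by transfer (simp add: scaleC_of_real)
  show "cinner f g = cnj (cinner g f)"
  proof -
    have "cnj (cinner g f) = (\<Sum>k. cnj (cinner (ell2_nth g k) (ell2_nth f k)))"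
      unfolding cinner_ell2_def
      by (rule bounded_linear.suminf[OF bounded_linear_cnj summable_cinner_ell2])
    then show ?thesis by (simp add: cinner_ell2_def cinner_commute[symmetric])
  qed
  show "cinner (f + g) h = cinner f h + cinner g h"
    by (simp add: cinner_ell2_def plus_ell2.rep_eq cinner_add_left suminf_add summable_cinner_ell2)
  show "cinner (c *\<^sub>C f) g = c * cinner f g"
    by (simp add: cinner_ell2_def scaleC_ell2.rep_eq cinner_scaleC_left suminf_mult summable_cinner_ell2)
  show "Re (cinner f g) = inner f g"
    by (simp add: cinner_ell2_def inner_ell2_def Re_suminf summable_cinner_ell2 Re_cinner)
qed

end

lemma norm_ell2_sq: "(norm f)\<^sup>2 = (\<Sum>k. (norm (ell2_nth f k))\<^sup>2)"
  by (simp add: power2_norm_eq_inner inner_ell2_def)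

lemma sum_le_norm_ell2: "(\<Sum>k<N. (norm (ell2_nth f k))\<^sup>2) \<le> (norm f)\<^sup>2"
  unfolding norm_ell2_sq by (rule sum_le_suminf[OF summable_ell2]) auto

lemma norm_nth_le_ell2: "norm (ell2_nth f k) \<le> norm f"
proof -
  have "(norm (ell2_nth f k))\<^sup>2 \<le> (\<Sum>j<Suc k. (norm (ell2_nth f j))\<^sup>2)"
    by (simp add: sum_nonneg)
  also have "\<dots> \<le> (norm f)\<^sup>2" by (rule sum_le_norm_ell2)
  finally show ?thesis by (simp add: power2_le_iff_abs_le)
qed

instance ell2 :: (chilbert_space) chilbert_space
proof
  fix X :: "nat \<Rightarrow> 'a ell2" assume X: "Cauchy X"
  have "Cauchy (\<lambda>m. ell2_nth (X m) k)" for k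
    unfolding Cauchy_iff
  proof (intro allI impI)
    fix e :: real assume "0 < e"
    then obtain M where M: "\<And>m n. m \<ge> M \<Longrightarrow> n \<ge> M \<Longrightarrow> norm (X m - X n) < e"
      using X unfolding Cauchy_iff by blast
    show "\<exists>M. \<forall>m\<ge>M. \<forall>n\<ge>M. norm (ell2_nth (X m) k - ell2_nth (X n) k) < e"
    proof (intro exI allI impI)
      fix m n assume "m \<ge> M" "n \<ge> M"
      then show "norm (ell2_nth (X m) k - ell2_nth (X n) k) < e"
        using norm_nth_le_ell2[of "X m - X n" k] M[of m n] by (simp add: minus_ell2.rep_eq)
    qed
  qed
  then obtain a where a: "\<And>k. (\<lambda>m. ell2_nth (X m) k) \<longlonglongrightarrow> a k"
    unfolding Cauchy_convergent_iff convergent_def by metis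
  have *: "\<exists>M. \<forall>m\<ge>M. \<forall>N. (\<Sum>k<N. (norm (ell2_nth (X m) k - a k))\<^sup>2) \<le> e\<^sup>2" if "e > 0" for e
  proof -
    obtain M where M: "\<And>m n. m \<ge> M \<Longrightarrow> n \<ge> M \<Longrightarrow> norm (X m - X n) < e"
      using X \<open>e > 0\<close> unfolding Cauchy_iff by blast
    have "(\<Sum>k<N. (norm (ell2_nth (X m) k - a k))\<^sup>2) \<le> e\<^sup>2" if m: "m \<ge> M" for m N
    proof (rule LIMSEQ_le_const2)
      show "(\<lambda>n. \<Sum>k<N. (norm (ell2_nth (X m) k - ell2_nth (X n) k))\<^sup>2)
          \<longlonglongrightarrow> (\<Sum>k<N. (norm (ell2_nth (X m) k - a k))\<^sup>2)"
        by (intro tendsto_intros a)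
      have "(\<Sum>k<N. (norm (ell2_nth (X m) k - ell2_nth (X n) k))\<^sup>2) \<le> e\<^sup>2" if "n \<ge> M" for n
      proof -
        have "(\<Sum>k<N. (norm (ell2_nth (X m) k - ell2_nth (X n) k))\<^sup>2) \<le> (norm (X m - X n))\<^sup>2"
          using sum_le_norm_ell2[of "X m - X n" N] by (simp add: minus_ell2.rep_eq)
        also have "\<dots> \<le> e\<^sup>2"
          using M[OF m that] by (intro power_mono) auto
        finally show ?thesis .
      qed
      then show "\<exists>M. \<forall>n\<ge>M. (\<Sum>k<N. (norm (ell2_nth (X m) k - ell2_nth (X n) k))\<^sup>2) \<le> e\<^sup>2"
        by blast
    qed
    then show ?thesis by blast
  qed
  have sm: "summable (\<lambda>k. (norm (ell2_nth (X m) k - a k))\<^sup>2)"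
    if "\<forall>N. (\<Sum>k<N. (norm (ell2_nth (X m) k - a k))\<^sup>2) \<le> e" for m e
    by (rule summableI_nonneg_bounded[where x = e]) (use that in auto)
  obtain m where m: "\<forall>N. (\<Sum>k<N. (norm (ell2_nth (X m) k - a k))\<^sup>2) \<le> 1\<^sup>2"
    using *[of 1] by auto
  have "summable (\<lambda>k. (norm (a k - ell2_nth (X m) k))\<^sup>2)"
    using sm[OF m] by (simp add: norm_minus_commute)
  from summable_sq_add[OF this summable_ell2[of "X m"]]
  have "summable (\<lambda>k. (norm (a k))\<^sup>2)" by simp
  then have A: "ell2_nth (Abs_ell2 a) = a" by (simp add: Abs_ell2_inverse)
  have "X \<longlonglongrightarrow> Abs_ell2 a"
    unfolding LIMSEQ_iff
  proof (intro allI impI)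
    fix r :: real assume "r > 0"
    then obtain M where M: "\<And>m N. m \<ge> M \<Longrightarrow> (\<Sum>k<N. (norm (ell2_nth (X m) k - a k))\<^sup>2) \<le> (r/2)\<^sup>2"
      using *[of "r/2"] by auto
    have "norm (X m - Abs_ell2 a) < r" if "m \<ge> M" for m
    proof -
      have "(norm (X m - Abs_ell2 a))\<^sup>2 \<le> (r/2)\<^sup>2"
        unfolding norm_ell2_sq minus_ell2.rep_eq A
        by (rule suminf_le_const) (use sm M[OF that] in blast)+
      then have "norm (X m - Abs_ell2 a) \<le> r/2"
        using \<open>r > 0\<close> by (simp add: power2_le_iff_abs_le)
      then show ?thesis using \<open>r > 0\<close> by simp
    qed
    then show "\<exists>M. \<forall>m\<ge>M. norm (X m - Abs_ell2 a) < r" by blast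
  qed
  then show "convergent X" by (auto simp: convergent_def)
qed

section \<open>Operators on closed subspaces\<close>

text \<open>A Hilbert space is a closed subspace of a type of class \<^class>\<open>chilbert_space\<close>. An operator
  between such spaces is a function whose values outside its domain are irrelevant.\<close>

definition closed_csubspace :: "'a::complex_inner set \<Rightarrow> bool" where
  "closed_csubspace M \<longleftrightarrow> csubspace M \<and> closed M"

definition bounded_op :: "'a::complex_inner set \<Rightarrow> 'b::complex_inner set \<Rightarrow> ('a \<Rightarrow> 'b) \<Rightarrow> bool" where
  "bounded_op M N T \<longleftrightarrow>
     (\<forall>x\<in>M. T x \<in> N) \<and>
     (\<forall>x\<in>M. \<forall>y\<in>M. T (x + y) = T x + T y) \<and>
     (\<forall>c. \<forall>x\<in>M. T (c *\<^sub>C x) = c *\<^sub>C T x) \<and>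
     (\<exists>B. \<forall>x\<in>M. norm (T x) \<le> B * norm x)"

definition adj :: "'a::complex_inner set \<Rightarrow> ('a \<Rightarrow> 'b::complex_inner) \<Rightarrow> 'b \<Rightarrow> 'a" where
  "adj M T y = (THE x. x \<in> M \<and> (\<forall>z\<in>M. cinner (T z) y = cinner z x))"

definition proj :: "'a::complex_inner set \<Rightarrow> 'a \<Rightarrow> 'a" where
  "proj M x = (THE y. y \<in> M \<and> (\<forall>z\<in>M. cinner (x - y) z = 0))"

definition isometry_op :: "'a::complex_inner set \<Rightarrow> 'b::complex_inner set \<Rightarrow> ('a \<Rightarrow> 'b) \<Rightarrow> bool" where
  "isometry_op M N T \<longleftrightarrow> bounded_op M N T \<and> (\<forall>x\<in>M. norm (T x) = norm x)"

definition unitary_op :: "'a::complex_inner set \<Rightarrow> 'b::complex_inner set \<Rightarrow> ('a \<Rightarrow> 'b) \<Rightarrow> bool" where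
  "unitary_op M N U \<longleftrightarrow> isometry_op M N U \<and> U ` M = N"

definition contraction_op :: "('a::complex_inner \<Rightarrow> 'a) \<Rightarrow> bool" where
  "contraction_op T \<longleftrightarrow> bounded_op UNIV UNIV T \<and> (\<forall>x. norm (T x) \<le> norm x)"

definition positive_op :: "('a::complex_inner \<Rightarrow> 'a) \<Rightarrow> bool" where
  "positive_op A \<longleftrightarrow> bounded_op UNIV UNIV A \<and> (\<forall>x. cinner (A x) x \<in> \<real>\<^sub>\<ge>\<^sub>0)"

definition sqrt_op :: "('a::complex_inner \<Rightarrow> 'a) \<Rightarrow> 'a \<Rightarrow> 'a" where
  "sqrt_op A = (THE B. positive_op B \<and> B \<circ> B = A)"

definition defect_op :: "('a::complex_inner \<Rightarrow> 'a) \<Rightarrow> 'a \<Rightarrow> 'a" where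
  "defect_op T = sqrt_op (\<lambda>x. x - adj UNIV T (T x))"

definition defect_space :: "('a::complex_inner \<Rightarrow> 'a) \<Rightarrow> 'a set" where
  "defect_space T = closure (range (defect_op T))"

section \<open>Agler-Young tuples and their isometric dilations\<close>

text \<open>A tuple is a function on indices of which only the values at \<open>1, \<dots>, n\<close>
  (for fundamental operator tuples \<open>1, \<dots>, n - 1\<close>) matter.\<close>

definition fundamental_tuple ::
    "nat \<Rightarrow> (nat \<Rightarrow> 'a::complex_inner \<Rightarrow> 'a) \<Rightarrow> (nat \<Rightarrow> 'a \<Rightarrow> 'a) \<Rightarrow> bool" where
  "fundamental_tuple n S X \<longleftrightarrow>
     (\<forall>i\<in>{1..<n}. bounded_op (defect_space (S n)) (defect_space (S n)) (X i) \<and>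
        (\<forall>h. S i h - adj UNIV (S (n - i)) (S n h)
           = defect_op (S n) (X i (defect_op (S n) h))))"

definition AY_tuple :: "nat \<Rightarrow> (nat \<Rightarrow> 'a::complex_inner \<Rightarrow> 'a) \<Rightarrow> bool" where
  "AY_tuple n S \<longleftrightarrow>
     (\<forall>i\<in>{1..n}. bounded_op UNIV UNIV (S i)) \<and> contraction_op (S n) \<and>
     (\<exists>X. fundamental_tuple n S X)"

definition AY_isometry :: "nat \<Rightarrow> 'a::complex_inner set \<Rightarrow> (nat \<Rightarrow> 'a \<Rightarrow> 'a) \<Rightarrow> bool" where
  "AY_isometry n K V \<longleftrightarrow>
     (\<forall>i\<in>{1..n}. bounded_op K K (V i)) \<and> isometry_op K K (V n) \<and>
     (\<forall>i\<in>{1..<n}. \<forall>x\<in>K. V i x = adj K (V (n - i)) (V n x))"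

text \<open>The inclusion of the space \<open>'a\<close> of \<open>S\<close> in \<open>K\<close> is an isometric embedding \<open>J\<close>. For a word
  \<open>w = [i\<^sub>1, \<dots>, i\<^sub>k]\<close> the vector \<open>foldr S w h\<close> is \<open>S i\<^sub>1 (\<dots> (S i\<^sub>k h))\<close>.\<close>

definition dilation ::
    "nat \<Rightarrow> 'b::complex_inner set \<Rightarrow> ('a::complex_inner \<Rightarrow> 'b) \<Rightarrow> (nat \<Rightarrow> 'b \<Rightarrow> 'b) \<Rightarrow> (nat \<Rightarrow> 'a \<Rightarrow> 'a) \<Rightarrow> bool"
  where
  "dilation n K J V S \<longleftrightarrow>
     closed_csubspace K \<and> isometry_op UNIV K J \<and> (\<forall>i\<in>{1..n}. bounded_op K K (V i)) \<and>
     (\<forall>w h. w \<noteq> [] \<and> set w \<subseteq> {1..n} \<longrightarrow> J (foldr S w h) = proj (range J) (foldr V w (J h)))"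

definition AY_isometric_dilation ::
    "nat \<Rightarrow> 'b::complex_inner set \<Rightarrow> ('a::complex_inner \<Rightarrow> 'b) \<Rightarrow> (nat \<Rightarrow> 'b \<Rightarrow> 'b) \<Rightarrow> (nat \<Rightarrow> 'a \<Rightarrow> 'a) \<Rightarrow> bool"
  where
  "AY_isometric_dilation n K J V S \<longleftrightarrow> dilation n K J V S \<and> AY_isometry n K V"

definition coinvariant ::
    "nat \<Rightarrow> 'b::complex_inner set \<Rightarrow> 'b set \<Rightarrow> (nat \<Rightarrow> 'b \<Rightarrow> 'b) \<Rightarrow> bool" where
  "coinvariant n K M V \<longleftrightarrow> M \<subseteq> K \<and> (\<forall>i\<in>{1..n}. adj K (V i) ` M \<subseteq> M)"

definition unitarily_equivalent ::
    "nat \<Rightarrow> 'a::complex_inner set \<Rightarrow> (nat \<Rightarrow> 'a \<Rightarrow> 'a) \<Rightarrow> 'b::complex_inner set \<Rightarrow> (nat \<Rightarrow> 'b \<Rightarrow> 'b) \<Rightarrow> bool"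
  where
  "unitarily_equivalent n K V L W \<longleftrightarrow>
     (\<exists>U. unitary_op K L U \<and> (\<forall>i\<in>{1..n}. \<forall>x\<in>K. U (V i x) = W i (U x)))"

definition minimal_isometric_dilation ::
    "'b::complex_inner set \<Rightarrow> ('a::complex_inner \<Rightarrow> 'b) \<Rightarrow> ('b \<Rightarrow> 'b) \<Rightarrow> ('a \<Rightarrow> 'a) \<Rightarrow> bool" where
  "minimal_isometric_dilation K J W A \<longleftrightarrow>
     closed_csubspace K \<and> isometry_op UNIV K J \<and> isometry_op K K W \<and>
     (\<forall>m\<ge>1. \<forall>h. J ((A ^^ m) h) = proj (range J) ((W ^^ m) (J h))) \<and>
     K = closure (cspan {(W ^^ m) (J h) |m h. True})"

section \<open>The canonical dilation\<close>

definition K0 :: "('a::complex_inner \<Rightarrow> 'a) \<Rightarrow> 'a ell2 set" where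
  "K0 T = {f. \<forall>k\<ge>1. ell2_nth f k \<in> defect_space T}"

definition embed0 :: "'a::complex_inner \<Rightarrow> 'a ell2" where
  "embed0 h = Abs_ell2 (\<lambda>k. if k = 0 then h else 0)"

text \<open>On \<open>K0\<close> the sequences below are square-summable, so that \<^const>\<open>Abs_ell2\<close> is applied
  inside its domain.\<close>

definition V_last :: "('a::complex_inner \<Rightarrow> 'a) \<Rightarrow> 'a ell2 \<Rightarrow> 'a ell2" where
  "V_last T f = Abs_ell2 (\<lambda>k. case k of
       0 \<Rightarrow> T (ell2_nth f 0)
     | Suc 0 \<Rightarrow> defect_op T (ell2_nth f 0)
     | Suc (Suc j) \<Rightarrow> ell2_nth f (Suc j))"

definition V_fund ::
    "nat \<Rightarrow> (nat \<Rightarrow> 'a::complex_inner \<Rightarrow> 'a) \<Rightarrow> (nat \<Rightarrow> 'a \<Rightarrow> 'a) \<Rightarrow> nat \<Rightarrow> 'a ell2 \<Rightarrow> 'a ell2" where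
  "V_fund n S X i f = Abs_ell2 (\<lambda>k. case k of
       0 \<Rightarrow> S i (ell2_nth f 0)
     | Suc 0 \<Rightarrow> adj (defect_space (S n)) (X (n - i)) (defect_op (S n) (ell2_nth f 0))
                 + X i (ell2_nth f 1)
     | Suc (Suc j) \<Rightarrow> adj (defect_space (S n)) (X (n - i)) (ell2_nth f (Suc j))
                 + X i (ell2_nth f (Suc (Suc j))))"

definition V_tuple ::
    "nat \<Rightarrow> (nat \<Rightarrow> 'a::complex_inner \<Rightarrow> 'a) \<Rightarrow> (nat \<Rightarrow> 'a \<Rightarrow> 'a) \<Rightarrow> nat \<Rightarrow> 'a ell2 \<Rightarrow> 'a ell2" where
  "V_tuple n S X = (V_fund n S X)(n := V_last (S n))"

end

theory Submission
  imports Defs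
begin

text \<open>Write \<open>T\<close> for \<open>S n\<close>. The adjoint relation \<open>V i = (V (n - i))\<^sup>* (V n)\<close> for the canonical tuple reduces,
  componentwise, to the defining equation \<open>S i - (S (n - i))\<^sup>* T = D (X i) D\<close>. For any Agler-Young isometric
  dilation \<open>W\<close>, applying \<open>W i = (W (n - i))\<^sup>* (W n)\<close> twice shows that \<open>W i\<close> is a Toeplitz operator with
  respect to the isometry \<open>W n\<close>; applying it once moves a power of \<open>W n\<close> across the inner product.
  Hence \<open>\<langle>W i (W n)\<^sup>j h, (W n)\<^sup>m h'\<rangle>\<close> depends only on \<open>S\<close>, and so does the Gram matrix of the vectors
  \<open>(W n)\<^sup>m h\<close>. When these vectors span, as they do in \<open>K0\<close>, the tuple is therefore determined up to a
  unique unitary matching them, which gives both uniqueness claims. Square roots of \<open>1 - T\<^sup>* T\<close> are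
  obtained from the power series of \<open>sqrt (1 - t)\<close>.\<close>


subsection \<open>Inner products\<close>

text \<open>\<open>sqrt_op\<close> is a definite description, so nothing is known about the defect
  operator D until a positive square root of 1 - T* T is shown to exist and to be unique. The power
  series serves both ends. Its coefficients after the first are nonpositive with absolute sum at
  most 1, so it converges for every contraction, norm 1 included, and its sum is positive. It also
  commutes with every bounded operator that commutes with T* T, and this commutation is what lets an
  arbitrary positive root be compared with it. Both uniqueness claims are instances of
  \<open>minimal_dilation_unique\<close>. In claim (2) the matching unitary fixes the generating
  vectors and is therefore the identity; in claim (3) it is the required equivalence. That
  \<open>V_last T\<close> generates \<open>K0 T\<close> rests on one observation: subtracting T h in
  slot 0 from the image of h leaves D h alone in slot 1.\<close>

instance chilbert_space \<subseteq> banach ..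

lemma cinner_add_right: "cinner (x::'a::complex_inner) (y + z) = cinner x y + cinner x z"
  by (metis cinner_add_left cinner_commute complex_cnj_add)

lemma cinner_scaleC_right: "cinner (x::'a::complex_inner) (a *\<^sub>C y) = cnj a * cinner x y"
  by (metis cinner_commute cinner_scaleC_left complex_cnj_mult)

lemma scaleC_minus_one: "(-1) *\<^sub>C (x::'a::complex_inner) = - x"
  using scaleC_of_real[of "-1" x] by simp

lemma scaleC_zero_right: "a *\<^sub>C (0::'a::complex_inner) = 0"
  using norm_scaleC[of a "0::'a"] by simp

lemma cinner_zero_left: "cinner 0 (x::'a::complex_inner) = 0"
  using cinner_scaleC_left[of 0 0 x] by (simp add: scaleC_zero_right)

lemma cinner_zero_right: "cinner (x::'a::complex_inner) 0 = 0"
  by (metis cinner_commute cinner_zero_left complex_cnj_zero)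

lemma cinner_diff_left: "cinner (x - y) (z::'a::complex_inner) = cinner x z - cinner y z"
  by (metis add_diff_cancel_right' cinner_add_left diff_add_cancel)

lemma cinner_diff_right: "cinner (x::'a::complex_inner) (y - z) = cinner x y - cinner x z"
  by (metis add_diff_cancel_right' cinner_add_right diff_add_cancel)

lemmas cinner_linear = cinner_add_left cinner_add_right cinner_diff_left cinner_diff_right
  cinner_scaleC_left cinner_scaleC_right cinner_zero_left cinner_zero_right

lemma cinner_self: "cinner (x::'a::complex_inner) x = of_real ((norm x)\<^sup>2)"
proof (rule complex_eqI)
  show "Re (cinner x x) = Re (of_real ((norm x)\<^sup>2))"
    by (simp add: Re_cinner power2_norm_eq_inner)
  have "Im (cinner x x) = Im (cnj (cinner x x))"
    by (metis cinner_commute)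
  then show "Im (cinner x x) = Im (of_real ((norm x)\<^sup>2))"
    by simp
qed

text \<open>Recovers the complex form from the real one, so that real polarisation is enough in
  \<open>isometry_cinner\<close>.\<close>

lemma cinner_of_Re:
  "cinner (z::'a::complex_inner) x
    = complex_of_real (inner z x) - \<i> * complex_of_real (inner (\<i> *\<^sub>C z) x)"
  by (simp add: complex_eq_iff Re_cinner Im_cinner)

lemma bounded_bilinear_cinner: "bounded_bilinear (cinner :: 'a::complex_inner \<Rightarrow> 'a \<Rightarrow> complex)"
proof
  show "cinner (r *\<^sub>R a) b = r *\<^sub>R cinner a b" "cinner a (r *\<^sub>R b) = r *\<^sub>R cinner a b"
    for r and a b :: 'a
    by (simp_all add: scaleC_of_real[symmetric] cinner_linear scaleR_conv_of_real scaleC_complex_def)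
  show "\<exists>K. \<forall>a b::'a. norm (cinner a b) \<le> norm a * norm b * K"
    by (intro exI[of _ 2] allI order_trans[OF norm_cinner_le]) simp
qed (simp_all add: cinner_linear)

lemmas tendsto_cinner = bounded_bilinear.tendsto[OF bounded_bilinear_cinner]

lemma tendsto_scaleC:
  "(f \<longlongrightarrow> x) F \<Longrightarrow> ((\<lambda>k. a *\<^sub>C f k) \<longlongrightarrow> a *\<^sub>C (x::'a::complex_inner)) F"
proof -
  have "bounded_linear (\<lambda>x::'a. a *\<^sub>C x)"
  proof (rule bounded_linear_intro[where K = "norm a"])
    show "a *\<^sub>C r *\<^sub>R x = r *\<^sub>R a *\<^sub>C x" for r and x :: 'a
      by (simp add: scaleC_of_real[symmetric] scaleC_scaleC mult.commute)
  qed (simp_all add: scaleC_add_right norm_scaleC mult.commute)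
  then show "(f \<longlongrightarrow> x) F \<Longrightarrow> ((\<lambda>k. a *\<^sub>C f k) \<longlongrightarrow> a *\<^sub>C x) F"
    by (rule bounded_linear.tendsto)
qed

subsection \<open>Subspaces and operators on them\<close>

lemma csubspaceD:
  assumes "csubspace M"
  shows "0 \<in> M" "x \<in> M \<Longrightarrow> y \<in> M \<Longrightarrow> x + y \<in> M" "x \<in> M \<Longrightarrow> a *\<^sub>C x \<in> M"
    "x \<in> M \<Longrightarrow> y \<in> M \<Longrightarrow> x - y \<in> M" "x \<in> M \<Longrightarrow> r *\<^sub>R x \<in> M"
  using assms cvec.subspace_0 cvec.subspace_add cvec.subspace_scale cvec.subspace_diff
  by (auto simp: scaleC_of_real[symmetric])

lemma csubspaceI:
  "0 \<in> M \<Longrightarrow> (\<And>x y. x \<in> M \<Longrightarrow> y \<in> M \<Longrightarrow> x + y \<in> M) \<Longrightarrow> (\<And>a x. x \<in> M \<Longrightarrow> a *\<^sub>C x \<in> M)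
    \<Longrightarrow> csubspace (M :: 'a::complex_inner set)"
  by (simp add: cvec.subspace_def)

lemma csubspace_closure:
  assumes "csubspace M" shows "csubspace (closure M)"
proof (rule csubspaceI)
  show "0 \<in> closure M" using csubspaceD(1)[OF assms] closure_subset by blast
next
  fix x y assume "x \<in> closure M" "y \<in> closure M"
  then obtain f g where "\<forall>n. f n \<in> M" "f \<longlonglongrightarrow> x" "\<forall>n. g n \<in> M" "g \<longlonglongrightarrow> y"
    by (auto simp: closure_sequential)
  then have "\<forall>n. f n + g n \<in> M" "(\<lambda>n. f n + g n) \<longlonglongrightarrow> x + y"
    using csubspaceD(2)[OF assms] by (auto intro: tendsto_add)
  then show "x + y \<in> closure M"
    unfolding closure_sequential by (intro exI[of _ "\<lambda>n. f n + g n"]) simp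
next
  fix a x assume "x \<in> closure M"
  then obtain f where "\<forall>n. f n \<in> M" "f \<longlonglongrightarrow> x"
    by (auto simp: closure_sequential)
  then have "\<forall>n. a *\<^sub>C f n \<in> M" "(\<lambda>n. a *\<^sub>C f n) \<longlonglongrightarrow> a *\<^sub>C x"
    using csubspaceD(3)[OF assms] by (auto intro: tendsto_scaleC)
  then show "a *\<^sub>C x \<in> closure M"
    unfolding closure_sequential by (intro exI[of _ "\<lambda>n. a *\<^sub>C f n"]) simp
qed

lemma csubspace_UNIV: "csubspace UNIV"
  by (rule csubspaceI) simp_all

lemma closed_csubspace_UNIV: "closed_csubspace UNIV"
  by (simp add: closed_csubspace_def csubspace_UNIV)

lemma bounded_opD:
  assumes "bounded_op M N T"
  shows "x \<in> M \<Longrightarrow> T x \<in> N" "x \<in> M \<Longrightarrow> y \<in> M \<Longrightarrow> T (x + y) = T x + T y"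
    "x \<in> M \<Longrightarrow> T (a *\<^sub>C x) = a *\<^sub>C T x"
  using assms by (auto simp: bounded_op_def)

text \<open>On the zero space \<open>bounded_op\<close> also accepts a negative bound. Later
  estimates multiply inequalities by the bound, so a nonnegative one is extracted here.\<close>

lemma bounded_op_bound:
  assumes "bounded_op M N T"
  obtains B where "0 \<le> B" "\<And>x. x \<in> M \<Longrightarrow> norm (T x) \<le> B * norm x"
proof -
  obtain B where B: "\<And>x. x \<in> M \<Longrightarrow> norm (T x) \<le> B * norm x"
    using assms unfolding bounded_op_def by blast
  show thesis
  proof
    show "norm (T x) \<le> \<bar>B\<bar> * norm x" if "x \<in> M" for x
      by (rule order_trans[OF B[OF that] mult_right_mono]) simp_all
  qed simp
qed

lemma bounded_op_diff:
  assumes "csubspace M" "bounded_op M N T" "x \<in> M" "y \<in> M"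
  shows "T (x - y) = T x - T y"
proof -
  have "T (x + (-1) *\<^sub>C y) = T x + (-1) *\<^sub>C T y"
    using bounded_opD(2)[OF assms(2,3) csubspaceD(3)[OF assms(1,4)]] bounded_opD(3)[OF assms(2,4)]
    by metis
  then show ?thesis by (simp add: scaleC_minus_one)
qed

lemma bounded_op_zero: "csubspace M \<Longrightarrow> bounded_op M N T \<Longrightarrow> T 0 = 0"
  using bounded_op_diff[of M N T 0 0] csubspaceD(1)[of M] by simp

lemma bounded_op_tendsto:
  assumes "csubspace M" "bounded_op M N T" "\<And>k. f k \<in> M" "x \<in> M" "f \<longlonglongrightarrow> x"
  shows "(\<lambda>k. T (f k)) \<longlonglongrightarrow> T x"
proof -
  obtain B where B: "0 \<le> B" "\<And>x. x \<in> M \<Longrightarrow> norm (T x) \<le> B * norm x"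
    using bounded_op_bound[OF assms(2)] by blast
  have "(\<lambda>k. T (f k) - T x) \<longlonglongrightarrow> 0"
  proof (rule Lim_null_comparison)
    have "norm (T (f k) - T x) \<le> B * norm (f k - x)" for k
      using B(2)[of "f k - x"] assms csubspaceD(4)[OF assms(1)] bounded_op_diff[OF assms(1,2)]
      by simp
    then show "\<forall>\<^sub>F k in sequentially. norm (T (f k) - T x) \<le> B * norm (f k - x)" by simp
    have "(\<lambda>k. B * norm (f k - x)) \<longlonglongrightarrow> B * norm (x - x)"
      by (intro tendsto_intros assms(5))
    then show "(\<lambda>k. B * norm (f k - x)) \<longlonglongrightarrow> 0" by simp
  qed
  then show ?thesis by (simp add: LIM_zero_iff)
qed

lemma bounded_op_compose:
  assumes "bounded_op M N T" "bounded_op L M R"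
  shows "bounded_op L N (\<lambda>x. T (R x))"
proof -
  obtain B C where B: "0 \<le> B" "\<And>x. x \<in> M \<Longrightarrow> norm (T x) \<le> B * norm x"
    and C: "0 \<le> C" "\<And>x. x \<in> L \<Longrightarrow> norm (R x) \<le> C * norm x"
    using bounded_op_bound[OF assms(1)] bounded_op_bound[OF assms(2)] by metis
  have "norm (T (R x)) \<le> (B * C) * norm x" if "x \<in> L" for x
    using B(2)[of "R x"] mult_left_mono[OF C(2)[OF that] B(1)] bounded_opD(1)[OF assms(2) that]
    by simp
  then show ?thesis
    using bounded_opD[OF assms(1)] bounded_opD[OF assms(2)] unfolding bounded_op_def by auto
qed

lemma bounded_op_funpow: "bounded_op M M T \<Longrightarrow> bounded_op M M (T ^^ m)"
proof (induction m)
  case 0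
  then show ?case by (auto simp: bounded_op_def intro!: exI[of _ 1])
next
  case (Suc m)
  then show ?case using bounded_op_compose[of M M T M "T ^^ m"] by (simp add: comp_def)
qed

lemma funpow_in: "bounded_op M M T \<Longrightarrow> x \<in> M \<Longrightarrow> (T ^^ m) x \<in> M"
  using bounded_op_funpow bounded_opD(1) by blast

lemma bounded_op_bounded_linear:
  assumes "bounded_op UNIV UNIV T" shows "bounded_linear T"
proof -
  obtain B where "\<And>x. norm (T x) \<le> B * norm x"
    using bounded_op_bound[OF assms] by (metis UNIV_I)
  then show ?thesis
    using bounded_opD[OF assms]
    by (intro bounded_linear_intro[where K = B]) (auto simp: scaleC_of_real[symmetric] mult.commute)
qed

subsection \<open>The Riesz theorem and adjoints\<close>

text \<open>The first-order condition at a minimum. It makes the minimiser in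
  \<open>riesz_real\<close> a representing vector, and in \<open>positive_op_null\<close> it turns a
  null vector of the form into a kernel vector.\<close>

lemma quadratic_linear_zero:
  fixes b c :: real
  assumes "\<And>t. 0 \<le> t\<^sup>2 * c + t * b"
  shows "b = 0"
proof (rule ccontr)
  assume "b \<noteq> 0"
  \<comment> \<open>As d exceeds both 0 and c, the test point t = - b / d gives the negative value
    (b / d)^2 (c - d), whatever the sign of c.\<close>
  define d where "d = \<bar>c\<bar> + 1"
  define t where "t = - b / d"
  have d: "0 < d" "c < d" by (auto simp: d_def)
  then have "t\<^sup>2 * c + t * b = b\<^sup>2 / d\<^sup>2 * (c - d)"
    by (simp add: t_def field_simps power2_eq_square)
  also have "\<dots> < 0"
    using \<open>b \<noteq> 0\<close> d by (intro mult_pos_neg) auto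
  finally show False using assms[of t] by simp
qed

text \<open>The representing vector minimises \<open>\<parallel>z\<parallel>\<^sup>2 - 2 f z\<close> over \<open>M\<close>.\<close>

lemma riesz_real:
  fixes M :: "'a::{real_inner,complete_space} set" and f :: "'a \<Rightarrow> real"
  assumes M: "subspace M" "closed M"
    and add: "\<And>x y. x \<in> M \<Longrightarrow> y \<in> M \<Longrightarrow> f (x + y) = f x + f y"
    and scale: "\<And>r x. x \<in> M \<Longrightarrow> f (r *\<^sub>R x) = r * f x"
    and bound: "\<And>x. x \<in> M \<Longrightarrow> \<bar>f x\<bar> \<le> B * norm x"
  obtains x where "x \<in> M" "\<And>z. z \<in> M \<Longrightarrow> f z = inner z x"
proof -
  define \<phi> where "\<phi> z = (norm z)\<^sup>2 - 2 * f z" for z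
  have lower: "- (B\<^sup>2) \<le> \<phi> z" if "z \<in> M" for z
    using bound[OF that] zero_le_power2[of "norm z - B"]
    by (auto simp: \<phi>_def power2_eq_square algebra_simps)
  have bdd: "bdd_below (\<phi> ` M)"
    using lower by (auto intro!: bdd_belowI[of _ "- (B\<^sup>2)"])
  have ne: "\<phi> ` M \<noteq> {}" using subspace_0[OF M(1)] by blast
  define m where "m = Inf (\<phi> ` M)"
  have m: "m \<le> \<phi> z" if "z \<in> M" for z
    unfolding m_def using that bdd by (auto intro: cInf_lower)
  have "\<exists>z. z \<in> M \<and> \<phi> z < m + inverse (real (Suc k))" for k
    using cInf_lessD[OF ne, of "m + inverse (real (Suc k))"] by (auto simp: m_def)
  then obtain g where g: "\<And>k. g k \<in> M" "\<And>k. \<phi> (g k) < m + inverse (real (Suc k))"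
    by metis
  \<comment> \<open>Parallelogram law: the midpoint of z and w has value at least m, so two
    near-minimisers must be close to each other.\<close>
  have par: "(norm (z - w))\<^sup>2 \<le> 2 * (\<phi> z - m) + 2 * (\<phi> w - m)" if "z \<in> M" "w \<in> M" for z w
  proof -
    have *: "(1/2) *\<^sub>R (z + w) \<in> M" using that M(1) by (simp add: subspace_add subspace_scale)
    have "\<phi> ((1/2) *\<^sub>R (z + w)) = (norm (z + w))\<^sup>2 / 4 - (f z + f w)"
      using that subspace_add[OF M(1)]
      by (simp add: \<phi>_def scale add power_divide add_divide_distrib)
    moreover have "(norm (z + w))\<^sup>2 + (norm (z - w))\<^sup>2 = 2 * (norm z)\<^sup>2 + 2 * (norm w)\<^sup>2"
      by (simp add: power2_norm_eq_inner inner_simps inner_commute)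
    ultimately show ?thesis
      using m[OF *] by (simp add: \<phi>_def)
  qed
  have "Cauchy g"
    unfolding Cauchy_altdef2
  proof (intro allI impI)
    fix e :: real assume "e > 0"
    \<comment> \<open>The quotient by 4 arises because \<open>par\<close> counts the excess over m
      twice for each of the two vectors.\<close>
    then obtain N where N: "inverse (real (Suc N)) < e\<^sup>2 / 4"
      using reals_Archimedean[of "e\<^sup>2 / 4"] by auto
    show "\<exists>N. \<forall>n\<ge>N. dist (g n) (g N) < e"
    proof (intro exI allI impI)
      fix n assume "n \<ge> N"
      then have "inverse (real (Suc n)) \<le> inverse (real (Suc N))"
        by (simp add: le_imp_inverse_le)
      then have "(norm (g n - g N))\<^sup>2 < e\<^sup>2"
        using par[OF g(1) g(1), of n N] g(2)[of n] g(2)[of N] N by argo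
      then show "dist (g n) (g N) < e"
        using \<open>e > 0\<close> by (simp add: dist_norm power_less_imp_less_base)
    qed
  qed
  then obtain x where x: "g \<longlonglongrightarrow> x"
    using Cauchy_convergent_iff convergent_def by metis
  have xM: "x \<in> M" using M(2) g(1) x closed_sequentially by blast
  have f_diff: "f (u - v) = f u - f v" if "u \<in> M" "v \<in> M" for u v
    using add[of u "(-1) *\<^sub>R v"] scale[of v "-1"] that subspace_scale[OF M(1), of v "-1"] by simp
  have "(\<lambda>k. f (g k) - f x) \<longlonglongrightarrow> 0"
  proof (rule Lim_null_comparison)
    show "\<forall>\<^sub>F k in sequentially. norm (f (g k) - f x) \<le> B * norm (g k - x)"
      using bound[OF subspace_diff[OF M(1) g(1) xM]] f_diff[OF g(1) xM] by simp
    have "(\<lambda>k. B * norm (g k - x)) \<longlonglongrightarrow> B * norm (x - x)" by (intro tendsto_intros x)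
    then show "(\<lambda>k. B * norm (g k - x)) \<longlonglongrightarrow> 0" by simp
  qed
  then have "(\<lambda>k. \<phi> (g k)) \<longlonglongrightarrow> \<phi> x"
    unfolding \<phi>_def by (intro tendsto_intros x) (simp add: LIM_zero_iff)
  moreover have "(\<lambda>k. m + inverse (real (Suc k))) \<longlonglongrightarrow> m"
    by (rule LIMSEQ_inverse_real_of_nat_add)
  ultimately have "\<phi> x \<le> m"
    using g(2) by (intro LIMSEQ_le[of "\<lambda>k. \<phi> (g k)" _ "\<lambda>k. m + inverse (real (Suc k))"])
      (auto intro: less_imp_le)
  then have min: "\<phi> x \<le> \<phi> z" if "z \<in> M" for z
    using m[OF that] by simp
  have "f z = inner z x" if z: "z \<in> M" for z
  proof -
    have "0 \<le> t\<^sup>2 * (norm z)\<^sup>2 + t * (2 * (inner z x - f z))" for t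
    proof -
      have tz: "t *\<^sub>R z \<in> M" "x + t *\<^sub>R z \<in> M"
        using z xM M(1) by (simp_all add: subspace_add subspace_scale)
      have "\<phi> (x + t *\<^sub>R z) = \<phi> x + (t\<^sup>2 * (norm z)\<^sup>2 + t * (2 * (inner z x - f z)))"
        using xM z tz unfolding \<phi>_def power2_norm_eq_inner
        by (simp add: add scale inner_simps inner_commute[of x z] power2_eq_square algebra_simps)
      then show ?thesis using min[OF tz(2)] by simp
    qed
    from quadratic_linear_zero[OF this] show ?thesis by simp
  qed
  with xM show thesis by (rule that)
qed

text \<open>The vector that represents the real part of f already represents f: evaluating the real
  identity at i z yields the imaginary part.\<close>

lemma riesz:
  fixes M :: "'a::chilbert_space set" and f :: "'a \<Rightarrow> complex"
  assumes M: "closed_csubspace M"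
    and add: "\<And>x y. x \<in> M \<Longrightarrow> y \<in> M \<Longrightarrow> f (x + y) = f x + f y"
    and scale: "\<And>a x. x \<in> M \<Longrightarrow> f (a *\<^sub>C x) = a * f x"
    and bound: "\<And>x. x \<in> M \<Longrightarrow> norm (f x) \<le> B * norm x"
  obtains x where "x \<in> M" "\<And>z. z \<in> M \<Longrightarrow> f z = cinner z x"
proof -
  have sub: "csubspace M" and cl: "closed M" using M by (simp_all add: closed_csubspace_def)
  have "subspace M" using csubspaceD[OF sub] by (simp add: subspace_def)
  then obtain x where x: "x \<in> M" "\<And>z. z \<in> M \<Longrightarrow> Re (f z) = inner z x"
  proof (rule riesz_real[OF _ cl, of "\<lambda>z. Re (f z)" B])
    show "\<bar>Re (f x)\<bar> \<le> B * norm x" if "x \<in> M" for x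
      using bound[OF that] abs_Re_le_cmod[of "f x"] by linarith
  qed (auto simp: add scale scaleC_of_real[symmetric])
  have "f z = cinner z x" if z: "z \<in> M" for z
  proof -
    have "Re (f (\<i> *\<^sub>C z)) = - Im (f z)"
      using z by (simp add: scale)
    then have "Im (f z) = - inner (\<i> *\<^sub>C z) x"
      using x(2)[OF csubspaceD(3)[OF sub z]] by simp
    with x(2)[OF z] show ?thesis
      by (simp add: complex_eq_iff Re_cinner Im_cinner)
  qed
  with x(1) show thesis by (rule that)
qed

lemma cinner_eqI:
  assumes "csubspace M" "x \<in> M" "y \<in> M" "\<And>z. z \<in> M \<Longrightarrow> cinner z x = cinner z y"
  shows "x = (y :: 'a::complex_inner)"
proof -
  have "cinner (x - y) (x - y) = 0"
    using assms(4)[of "x - y"] csubspaceD(4)[OF assms(1-3)] by (simp add: cinner_diff_right)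
  then show ?thesis by (simp add: cinner_self)
qed

lemma adj_eqI:
  assumes "csubspace M" "x \<in> M" "\<And>z. z \<in> M \<Longrightarrow> cinner (T z) y = cinner z x"
  shows "adj M T y = x"
  unfolding adj_def using assms by (auto intro!: the_equality cinner_eqI[OF assms(1)])

text \<open>Riesz applied to the functional sending z to \<open>cinner (T z) y\<close>. The vector y
  ranges over the whole type, so \<open>adj M T\<close> is a total map into M; this is why
  \<open>bounded_op_adj\<close> has domain \<open>UNIV\<close>.\<close>

lemma
  fixes M :: "'a::chilbert_space set"
  assumes "closed_csubspace M" "bounded_op M N T"
  shows adj_in: "adj M T y \<in> M"
    and cinner_adj_right: "z \<in> M \<Longrightarrow> cinner z (adj M T y) = cinner (T z) y"
    and cinner_adj_left: "z \<in> M \<Longrightarrow> cinner (adj M T y) z = cinner y (T z)"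
proof -
  obtain B where B: "0 \<le> B" "\<And>x. x \<in> M \<Longrightarrow> norm (T x) \<le> B * norm x"
    using bounded_op_bound[OF assms(2)] by blast
  obtain x where x: "x \<in> M" "\<And>z. z \<in> M \<Longrightarrow> cinner (T z) y = cinner z x"
  proof (rule riesz[OF assms(1), of "\<lambda>z. cinner (T z) y" "2 * B * norm y"])
    show "norm (cinner (T z) y) \<le> 2 * B * norm y * norm z" if "z \<in> M" for z
      using norm_cinner_le[of "T z" y] mult_right_mono[OF B(2)[OF that], of "norm y"]
      by (simp add: mult.commute mult.left_commute)
  qed (simp_all add: bounded_opD[OF assms(2)] cinner_linear)
  have eq: "adj M T y = x"
    using assms(1) x by (intro adj_eqI) (auto simp: closed_csubspace_def)
  show "adj M T y \<in> M" using eq x by simp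
  show R: "cinner z (adj M T y) = cinner (T z) y" if "z \<in> M" for z using eq x that by simp
  show "cinner (adj M T y) z = cinner y (T z)" if "z \<in> M"
    using R[OF that] by (metis cinner_commute)
qed

text \<open>The adjoint inherits the bound of T itself, which makes T* T a contraction when T is
  one. The factor 2 of \<open>norm_cinner_le\<close> would spoil this, so the proof goes through the
  real Cauchy-Schwarz inequality.\<close>

lemma norm_adj_le:
  fixes M :: "'a::chilbert_space set"
  assumes "closed_csubspace M" "bounded_op M N T"
    and "\<And>x. x \<in> M \<Longrightarrow> norm (T x) \<le> B * norm x" "0 \<le> B"
  shows "norm (adj M T y) \<le> B * norm y"
proof -
  let ?x = "adj M T y"
  have x: "?x \<in> M" by (rule adj_in[OF assms(1,2)])
  have "(norm ?x)\<^sup>2 = Re (cinner (T ?x) y)"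
    unfolding cinner_adj_right[OF assms(1,2) x, symmetric] by (simp add: cinner_self)
  also have "\<dots> \<le> norm (T ?x) * norm y"
    unfolding Re_cinner by (rule norm_cauchy_schwarz)
  also have "\<dots> \<le> B * norm ?x * norm y"
    by (intro mult_right_mono assms(3) x) simp
  finally show ?thesis
    using assms(4) by (cases "?x = 0") (auto simp: power2_eq_square)
qed

lemma bounded_op_adj:
  fixes M :: "'a::chilbert_space set"
  assumes "closed_csubspace M" "bounded_op M N T"
  shows "bounded_op UNIV M (adj M T)"
proof -
  have M: "csubspace M" using assms(1) by (simp add: closed_csubspace_def)
  note [simp] = cinner_adj_right[OF assms] adj_in[OF assms] csubspaceD(2,3)[OF M]
  obtain B where "0 \<le> B" "\<And>x. x \<in> M \<Longrightarrow> norm (T x) \<le> B * norm x"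
    using bounded_op_bound[OF assms(2)] by blast
  then have "\<forall>y. norm (adj M T y) \<le> B * norm y"
    using norm_adj_le[OF assms] by blast
  moreover have "adj M T (x + y) = adj M T x + adj M T y" for x y
    by (rule adj_eqI[OF M]) (simp_all add: cinner_linear)
  moreover have "adj M T (a *\<^sub>C x) = a *\<^sub>C adj M T x" for a x
    by (rule adj_eqI[OF M]) (simp_all add: cinner_linear)
  ultimately show ?thesis unfolding bounded_op_def by auto
qed

text \<open>The projection onto M is the adjoint of the inclusion of M, so its existence reduces to
  Riesz.\<close>

lemma proj_cinner:
  fixes M :: "'a::chilbert_space set"
  assumes "closed_csubspace M"
  shows "proj M x \<in> M" "z \<in> M \<Longrightarrow> cinner (proj M x) z = cinner x z"
proof -
  have id: "bounded_op M M (\<lambda>x. x)"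
    by (auto simp: bounded_op_def intro!: exI[of _ 1])
  have M: "csubspace M" using assms by (simp add: closed_csubspace_def)
  have "proj M x = adj M (\<lambda>x. x) x"
    unfolding proj_def
  proof (rule the_equality)
    show "adj M (\<lambda>x. x) x \<in> M \<and> (\<forall>z\<in>M. cinner (x - adj M (\<lambda>x. x) x) z = 0)"
      using cinner_adj_left[OF assms id] adj_in[OF assms id] by (simp add: cinner_linear)
    fix y assume y: "y \<in> M \<and> (\<forall>z\<in>M. cinner (x - y) z = 0)"
    show "y = adj M (\<lambda>x. x) x"
    proof (rule adj_eqI[OF M, symmetric])
      show "cinner z x = cinner z y" if "z \<in> M" for z
        using y that by (metis cinner_commute cinner_diff_left eq_iff_diff_eq_0)
    qed (use y in simp)
  qed
  then show "proj M x \<in> M" "z \<in> M \<Longrightarrow> cinner (proj M x) z = cinner x z"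
    using cinner_adj_left[OF assms id] adj_in[OF assms id] by simp_all
qed

lemma proj_eqI:
  assumes "csubspace M" "y \<in> M" "\<And>z. z \<in> M \<Longrightarrow> cinner x z = cinner y (z::'a::complex_inner)"
  shows "proj M x = y"
  unfolding proj_def
proof (rule the_equality)
  fix y' assume y': "y' \<in> M \<and> (\<forall>z\<in>M. cinner (x - y') z = 0)"
  show "y' = y"
  proof (rule cinner_eqI[OF assms(1)])
    show "cinner z y' = cinner z y" if "z \<in> M" for z
      using y' assms(3)[OF that] that by (metis cinner_commute cinner_diff_left eq_iff_diff_eq_0)
  qed (use y' assms in auto)
qed (use assms in \<open>auto simp: cinner_linear\<close>)


subsection \<open>Square roots and defect operators\<close>

lemma infsum_eq_suminf:
  fixes f :: "nat \<Rightarrow> 'a::{comm_monoid_add,t2_space}"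
  shows "f summable_on UNIV \<Longrightarrow> infsum f UNIV = suminf f"
  by (rule sums_unique[OF has_sum_imp_sums[OF has_sum_infsum]])

text \<open>With \<open>v k = (B ^^ k) x\<close> this multiplies two power series in the operator B.
  The vectors are merely bounded, so absolute convergence of the double series rests on the
  coefficients alone.\<close>

lemma Cauchy_product_vector:
  fixes v :: "nat \<Rightarrow> 'a::banach" and a b :: "nat \<Rightarrow> real"
  assumes a: "summable (\<lambda>k. \<bar>a k\<bar>)" and b: "summable (\<lambda>k. \<bar>b k\<bar>)"
    and v: "\<And>k. norm (v k) \<le> C"
  shows "(\<Sum>j. a j *\<^sub>R (\<Sum>k. b k *\<^sub>R v (j + k))) = (\<Sum>n. (\<Sum>i\<le>n. a i * b (n - i)) *\<^sub>R v n)"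
proof -
  define f where "f = (\<lambda>(j, k). (a j * b k) *\<^sub>R v (j + k))"
  have C: "0 \<le> C" using v[of 0] norm_ge_zero order_trans by blast
  have A: "(\<lambda>k. \<bar>a k\<bar>) summable_on UNIV" and B: "(\<lambda>k. \<bar>b k\<bar>) summable_on UNIV"
    using a b by (simp_all add: summable_on_UNIV_nonneg_real_iff)
  have "(\<lambda>x. norm (case x of (j, k) \<Rightarrow> \<bar>a j\<bar> * (\<bar>b k\<bar> * C))) summable_on UNIV \<times> UNIV"
  proof (rule Infinite_Sum.abs_summable_on_Sigma_iff[THEN iffD2], intro conjI ballI)
    fix j
    show "(\<lambda>k. norm (case (j, k) of (j, k) \<Rightarrow> \<bar>a j\<bar> * (\<bar>b k\<bar> * C))) summable_on UNIV"
      using B C by (simp add: abs_mult summable_on_cmult_left summable_on_cmult_right)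
  next
    have "(\<Sum>\<^sub>\<infinity>k. norm (case (j, k) of (j, k) \<Rightarrow> \<bar>a j\<bar> * (\<bar>b k\<bar> * C)))
        = \<bar>a j\<bar> * (\<Sum>\<^sub>\<infinity>k. \<bar>b k\<bar> * C)" for j
      using B C by (simp add: abs_mult infsum_cmult_right summable_on_cmult_left)
    moreover have "0 \<le> (\<Sum>\<^sub>\<infinity>k. \<bar>b k\<bar> * C)"
      using C by (intro infsum_nonneg) simp
    ultimately show "(\<lambda>j. norm (\<Sum>\<^sub>\<infinity>k. norm (case (j, k) of (j, k) \<Rightarrow> \<bar>a j\<bar> * (\<bar>b k\<bar> * C))))
        summable_on UNIV"
      using A by (simp add: abs_mult summable_on_cmult_left)
  qed
  then have "(\<lambda>x. norm (f x)) summable_on UNIV \<times> UNIV"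
  proof (rule Infinite_Sum.abs_summable_on_comparison_test)
    fix x :: "nat \<times> nat"
    show "norm (f x) \<le> norm (case x of (j, k) \<Rightarrow> \<bar>a j\<bar> * (\<bar>b k\<bar> * C))"
      using v[of "fst x + snd x"] C
      by (auto simp: f_def case_prod_beta abs_mult mult.assoc intro!: mult_left_mono)
  qed
  then have f: "f summable_on UNIV \<times> UNIV" by (rule abs_summable_summable)
  have f1: "f summable_on (SIGMA j:UNIV. UNIV)" using f by simp
  \<comment> \<open>Antidiagonals: the pair (j, k) is listed at position i = j on the line n = j +
    k.\<close>
  have bij: "bij_betw (\<lambda>(n, i). (i, n - i)) (SIGMA n:UNIV. {..n}) (UNIV \<times> (UNIV::nat set))"
    by (rule bij_betwI[where g = "\<lambda>(j, k). (j + k, j)"]) auto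
  define g where "g = (\<lambda>(n, i). (a i * b (n - i)) *\<^sub>R v n)"
  have g_f: "g x = f (case x of (n, i) \<Rightarrow> (i, n - i))" if "x \<in> (SIGMA n:UNIV. {..n})" for x
    using that by (auto simp: f_def g_def)
  have g: "g summable_on (SIGMA n:UNIV. {..n})"
    using f summable_on_reindex_bij_betw[OF bij, of f] g_f
    by (metis (no_types, lifting) summable_on_cong)
  have "infsum g (SIGMA n:UNIV. {..n}) = infsum f (UNIV \<times> UNIV)"
    using infsum_reindex_bij_betw[OF bij, of f] g_f by (metis (no_types, lifting) infsum_cong)
  moreover have "infsum f (UNIV \<times> UNIV) = (\<Sum>j. a j *\<^sub>R (\<Sum>k. b k *\<^sub>R v (j + k)))"
  proof -
    have "(\<lambda>k. b k *\<^sub>R v (j + k)) summable_on UNIV" for j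
    proof (rule norm_summable_imp_summable_on, rule summable_comparison_test_ev)
      show "summable (\<lambda>k. \<bar>b k\<bar> * C)" using b by (rule summable_mult2)
      show "\<forall>\<^sub>F k in sequentially. norm (norm (b k *\<^sub>R v (j + k))) \<le> \<bar>b k\<bar> * C"
        using v by (simp add: mult_left_mono)
    qed
    then have inner: "(\<Sum>\<^sub>\<infinity>k. b k *\<^sub>R v (j + k)) = (\<Sum>k. b k *\<^sub>R v (j + k))" for j
      using has_sum_imp_sums[OF has_sum_infsum] sums_unique by blast
    have fj: "(\<lambda>k. f (j, k)) = (\<lambda>k. a j *\<^sub>R (b k *\<^sub>R v (j + k)))" for j
      by (auto simp: f_def)
    have "(\<Sum>\<^sub>\<infinity>k. f (j, k)) = a j *\<^sub>R (\<Sum>k. b k *\<^sub>R v (j + k))" for j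
      unfolding fj infsum_scaleR_right inner ..
    then have outer: "(\<lambda>j. \<Sum>\<^sub>\<infinity>k. f (j, k)) = (\<lambda>j. a j *\<^sub>R (\<Sum>k. b k *\<^sub>R v (j + k)))" ..
    have "(\<lambda>j. a j *\<^sub>R (\<Sum>k. b k *\<^sub>R v (j + k))) summable_on UNIV"
      using summable_on_Sigma_banach[of "\<lambda>j k. f (j, k)" UNIV "\<lambda>_. UNIV"] f1
      unfolding outer by simp
    from infsum_eq_suminf[OF this] show ?thesis
      using infsum_Sigma_banach[OF f1] unfolding outer by simp
  qed
  moreover have "infsum g (SIGMA n:UNIV. {..n}) = (\<Sum>n. (\<Sum>i\<le>n. a i * b (n - i)) *\<^sub>R v n)"
  proof -
    have "(\<Sum>\<^sub>\<infinity>i\<in>{..n}. g (n, i)) = (\<Sum>i\<le>n. a i * b (n - i)) *\<^sub>R v n" for n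
      by (simp add: g_def scaleR_sum_left)
    then have outer: "(\<lambda>n. \<Sum>\<^sub>\<infinity>i\<in>{..n}. g (n, i)) = (\<lambda>n. (\<Sum>i\<le>n. a i * b (n - i)) *\<^sub>R v n)" ..
    have "(\<lambda>n. (\<Sum>i\<le>n. a i * b (n - i)) *\<^sub>R v n) summable_on UNIV"
      using summable_on_Sigma_banach[of "\<lambda>n i. g (n, i)" UNIV "\<lambda>n. {..n}"] g
      unfolding outer by simp
    from infsum_eq_suminf[OF this] show ?thesis
      using infsum_Sigma_banach[OF g] unfolding outer by simp
  qed
  ultimately show ?thesis by simp
qed

text \<open>The Taylor coefficients of \<open>sqrt (1 - t)\<close>.\<close>

definition sqrt_coeff :: "nat \<Rightarrow> real" where
  "sqrt_coeff k = (-1) ^ k * ((1/2) gchoose k)"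

lemma sqrt_coeff_0: "sqrt_coeff 0 = 1"
  by (simp add: sqrt_coeff_def)

text \<open>All coefficients after the constant one have the same sign, so their absolute sums can
  be read off the plain partial sums.\<close>

lemma sqrt_coeff_nonpos: "sqrt_coeff (Suc k) \<le> 0"
proof -
  have "sqrt_coeff (Suc k) = - (1/2) * pochhammer (1/2) k / fact (Suc k)"
    by (simp add: sqrt_coeff_def gbinomial_pochhammer pochhammer_rec flip: power_mult_distrib)
  moreover have "0 \<le> pochhammer (1/2::real) k" by (intro pochhammer_nonneg) simp
  ultimately show ?thesis by (simp add: divide_nonpos_pos)
qed

text \<open>The partial sums of the series at t = 1 collapse to one binomial coefficient of -1/2 up
  to sign, which is a quotient of positive numbers.\<close>

lemma sum_sqrt_coeff_nonneg: "0 \<le> (\<Sum>k\<le>N. sqrt_coeff k)"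
proof -
  have "(\<Sum>k\<le>N. sqrt_coeff k) = (-1) ^ N * (- (1/2) gchoose N)"
    using gbinomial_sum_lower_neg[of "1/2::real" N] by (simp add: sqrt_coeff_def mult.commute)
  also have "\<dots> = pochhammer (1/2) N / fact N"
    by (simp add: gbinomial_pochhammer flip: power_mult_distrib)
  also have "0 \<le> \<dots>" by (intro divide_nonneg_pos pochhammer_nonneg) simp_all
  finally show ?thesis .
qed

text \<open>The decisive estimate: the later coefficients never outweigh the leading 1. It gives
  convergence for operators of norm 1 as well as positivity of the sum.\<close>

lemma sum_abs_sqrt_coeff_le: "(\<Sum>k<N. \<bar>sqrt_coeff (Suc k)\<bar>) \<le> 1"
proof -
  have "(\<Sum>k\<le>N. sqrt_coeff k) = 1 - (\<Sum>k<N. \<bar>sqrt_coeff (Suc k)\<bar>)"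
    by (simp add: sum.atMost_shift sqrt_coeff_0 sqrt_coeff_nonpos sum_negf)
  then show ?thesis using sum_sqrt_coeff_nonneg[of N] by simp
qed

lemma summable_abs_sqrt_coeff: "summable (\<lambda>k. \<bar>sqrt_coeff k\<bar>)"
  unfolding summable_Suc_iff[of "\<lambda>k. \<bar>sqrt_coeff k\<bar>", symmetric]
  using sum_abs_sqrt_coeff_le by (intro summableI_nonneg_bounded) auto

text \<open>The coefficients of (1 - t)^(1/2) times itself are those of 1 - t, by the Vandermonde
  identity with exponents 1/2 + 1/2 = 1.\<close>

lemma sqrt_coeff_square:
  "(\<Sum>i\<le>n. sqrt_coeff i * sqrt_coeff (n - i)) = (if n = 0 then 1 else if n = 1 then -1 else 0)"
proof -
  have "(\<Sum>i\<le>n. sqrt_coeff i * sqrt_coeff (n - i))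
      = (\<Sum>i\<le>n. (-1) ^ n * (((1/2) gchoose i) * ((1/2) gchoose (n - i))))"
    by (intro sum.cong) (auto simp: sqrt_coeff_def mult_ac simp flip: power_add)
  also have "\<dots> = (-1) ^ n * (1 gchoose n)"
    using gbinomial_Vandermonde[of "1/2::real" "1/2" n]
    by (simp add: sum_distrib_left[symmetric] atLeast0AtMost)
  also have "(1::real) gchoose n = of_nat (1 choose n)"
    by (metis binomial_gbinomial of_nat_1)
  also have "(-1) ^ n * real (1 choose n) = (if n = 0 then 1 else if n = 1 then -1 else 0)"
    by (cases n) (auto simp: binomial_eq_0)
  finally show ?thesis .
qed

section \<open>The operator series for sqrt (1 - B), with B a contraction\<close>

definition sqrt_series :: "('a::chilbert_space \<Rightarrow> 'a) \<Rightarrow> 'a \<Rightarrow> 'a" where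
  "sqrt_series B x = (\<Sum>k. sqrt_coeff k *\<^sub>R (B ^^ k) x)"

context
  fixes B :: "'a::chilbert_space \<Rightarrow> 'a"
  assumes B: "bounded_op UNIV UNIV B" and contr: "\<And>x. norm (B x) \<le> norm x"
begin

lemma norm_funpow_le: "norm ((B ^^ k) x) \<le> norm x"
  by (induction k) (auto intro: order_trans[OF contr])

lemma summable_sqrt_series: "summable (\<lambda>k. sqrt_coeff k *\<^sub>R (B ^^ k) x)"
proof (rule summable_comparison_test_ev)
  show "summable (\<lambda>k. \<bar>sqrt_coeff k\<bar> * norm x)"
    by (rule summable_mult2[OF summable_abs_sqrt_coeff])
qed (simp add: norm_funpow_le mult_left_mono)

text \<open>Serves two purposes: with Q a competing square root it feeds the uniqueness argument,
  and with Q multiplication by a complex scalar it gives homogeneity of the series, whose own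
  coefficients are real.\<close>

lemma sqrt_series_commute:
  assumes Q: "bounded_op UNIV UNIV Q" and comm: "\<And>x. Q (B x) = B (Q x)"
  shows "Q (sqrt_series B x) = sqrt_series B (Q x)"
proof -
  have lin: "bounded_linear Q" by (rule bounded_op_bounded_linear[OF Q])
  have "Q ((B ^^ k) x) = (B ^^ k) (Q x)" for k
    by (induction k) (auto simp: comm)
  then show ?thesis
    using bounded_linear.suminf[OF lin summable_sqrt_series[of x]]
    by (simp add: sqrt_series_def linear_scale[OF bounded_linear.linear[OF lin]])
qed

lemma sqrt_series_square: "sqrt_series B (sqrt_series B x) = x - B x"
proof -
  have lin: "bounded_linear (B ^^ j)" for j
    by (rule bounded_op_bounded_linear[OF bounded_op_funpow[OF B]])
  have "(B ^^ j) (sqrt_series B x) = (\<Sum>k. sqrt_coeff k *\<^sub>R (B ^^ (j + k)) x)" for j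
    using bounded_linear.suminf[OF lin summable_sqrt_series[of x], of j]
    by (simp add: sqrt_series_def linear_scale[OF bounded_linear.linear[OF lin]] funpow_add)
  then have "sqrt_series B (sqrt_series B x)
      = (\<Sum>j. sqrt_coeff j *\<^sub>R (\<Sum>k. sqrt_coeff k *\<^sub>R (B ^^ (j + k)) x))"
    by (subst sqrt_series_def) simp
  also have "\<dots> = (\<Sum>n. (if n = 0 then 1 else if n = 1 then -1 else 0) *\<^sub>R (B ^^ n) x)"
    using Cauchy_product_vector[of sqrt_coeff sqrt_coeff "\<lambda>k. (B ^^ k) x" "norm x",
        OF summable_abs_sqrt_coeff summable_abs_sqrt_coeff norm_funpow_le]
    unfolding sqrt_coeff_square .
  also have "\<dots> = (\<Sum>n\<in>{0, 1}. (if n = 0 then 1 else if n = 1 then -1 else 0) *\<^sub>R (B ^^ n) x)"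
    by (rule suminf_finite) auto
  finally show ?thesis by simp
qed

lemma bounded_op_sqrt_series: "bounded_op UNIV UNIV (sqrt_series B)"
proof -
  have lin: "bounded_op UNIV UNIV (B ^^ k)" for k by (rule bounded_op_funpow[OF B])
  have "sqrt_series B (x + y) = sqrt_series B x + sqrt_series B y" for x y
    unfolding sqrt_series_def
    by (subst suminf_add) (simp_all add: summable_sqrt_series bounded_opD(2)[OF lin] scaleR_add_right)
  moreover have "sqrt_series B (c *\<^sub>C x) = c *\<^sub>C sqrt_series B x" for c x
  proof -
    have "bounded_op UNIV UNIV (\<lambda>x::'a. c *\<^sub>C x)"
      unfolding bounded_op_def
      by (auto simp: scaleC_add_right scaleC_scaleC mult.commute norm_scaleC intro!: exI[of _ "norm c"])
    then show ?thesis
      using sqrt_series_commute[of "\<lambda>x. c *\<^sub>C x" x] bounded_opD(3)[OF B] by simp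
  qed
  moreover have "norm (sqrt_series B x) \<le> (\<Sum>k. \<bar>sqrt_coeff k\<bar>) * norm x" for x
  proof -
    have s: "summable (\<lambda>k. \<bar>sqrt_coeff k\<bar> * norm x)"
      by (rule summable_mult2[OF summable_abs_sqrt_coeff])
    have "norm (sqrt_series B x) \<le> (\<Sum>k. \<bar>sqrt_coeff k\<bar> * norm x)"
      unfolding sqrt_series_def
      by (rule norm_suminf_le[OF _ s]) (simp add: norm_funpow_le mult_left_mono)
    then show ?thesis
      by (simp add: suminf_mult2[OF summable_abs_sqrt_coeff])
  qed
  ultimately show ?thesis unfolding bounded_op_def by blast
qed

lemma sqrt_series_selfadjoint:
  assumes sa: "\<And>x y. cinner (B x) y = cinner x (B y)"
  shows "cinner (sqrt_series B x) y = cinner x (sqrt_series B y)"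
proof -
  have "cinner ((B ^^ k) x) y = cinner x ((B ^^ k) y)" for k
    by (induction k arbitrary: x y) (simp_all add: sa funpow_swap1)
  then show ?thesis
    using bounded_linear.suminf[OF bounded_bilinear.bounded_linear_left[OF bounded_bilinear_cinner, of y]
        summable_sqrt_series[of x]]
      bounded_linear.suminf[OF bounded_bilinear.bounded_linear_right[OF bounded_bilinear_cinner, of x]
        summable_sqrt_series[of y]]
    by (simp add: sqrt_series_def bounded_bilinear.scaleR_left[OF bounded_bilinear_cinner]
        bounded_bilinear.scaleR_right[OF bounded_bilinear_cinner])
qed

text \<open>The leading term contributes the squared norm of x. The k-th later term is at least
  minus the modulus of its coefficient times that squared norm, and these moduli add up to at most
  1.\<close>

lemma positive_sqrt_series:
  assumes sa: "\<And>x y. cinner (B x) y = cinner x (B y)"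
  shows "positive_op (sqrt_series B)"
proof -
  have "cinner (sqrt_series B x) x \<in> \<real>\<^sub>\<ge>\<^sub>0" for x
  proof -
    have "cinner (sqrt_series B x) x = cnj (cinner (sqrt_series B x) x)"
      using sqrt_series_selfadjoint[OF sa, of x x] by (metis cinner_commute)
    then have im: "Im (cinner (sqrt_series B x) x) = 0"
      by (metis cnj.simps(2) equal_neg_zero)
    have s: "summable (\<lambda>k. sqrt_coeff k * inner ((B ^^ k) x) x)"
      using bounded_linear.summable[OF bounded_linear_inner_left summable_sqrt_series[of x], of x] by simp
    have "inner (sqrt_series B x) x = (\<Sum>k. sqrt_coeff k * inner ((B ^^ k) x) x)"
      unfolding sqrt_series_def
      using bounded_linear.suminf[OF bounded_linear_inner_left summable_sqrt_series[of x], of x] by simp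
    also have "\<dots> \<ge> 0"
    proof (rule LIMSEQ_le_const[OF summable_LIMSEQ'[OF s]], intro exI allI impI)
      fix N
      have "- (\<bar>sqrt_coeff (Suc k)\<bar> * (norm x)\<^sup>2) \<le> sqrt_coeff (Suc k) * inner ((B ^^ Suc k) x) x" for k
      proof -
        have "\<bar>inner ((B ^^ Suc k) x) x\<bar> \<le> norm ((B ^^ Suc k) x) * norm x"
          by (rule Cauchy_Schwarz_ineq2)
        also have "\<dots> \<le> (norm x)\<^sup>2"
          unfolding power2_eq_square by (intro mult_right_mono norm_funpow_le) simp
        finally have "\<bar>sqrt_coeff (Suc k) * inner ((B ^^ Suc k) x) x\<bar> \<le> \<bar>sqrt_coeff (Suc k)\<bar> * (norm x)\<^sup>2"
          by (simp only: abs_mult mult_left_mono abs_ge_zero)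
        then show ?thesis by linarith
      qed
      then have "(\<Sum>k<N. - (\<bar>sqrt_coeff (Suc k)\<bar> * (norm x)\<^sup>2))
          \<le> (\<Sum>k<N. sqrt_coeff (Suc k) * inner ((B ^^ Suc k) x) x)"
        by (intro sum_mono)
      moreover have "(\<Sum>k<N. \<bar>sqrt_coeff (Suc k)\<bar> * (norm x)\<^sup>2) \<le> (norm x)\<^sup>2"
        using mult_right_mono[OF sum_abs_sqrt_coeff_le[of N], of "(norm x)\<^sup>2"]
        by (simp add: sum_distrib_right)
      ultimately show "0 \<le> (\<Sum>k\<le>N. sqrt_coeff k * inner ((B ^^ k) x) x)"
        unfolding sum.atMost_shift by (simp add: sqrt_coeff_0 power2_norm_eq_inner sum_negf)
    qed
    finally show ?thesis using im by (simp add: complex_nonneg_Reals_iff Re_cinner)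
  qed
  then show ?thesis using bounded_op_sqrt_series by (simp add: positive_op_def)
qed

end

section \<open>Positive operators and uniqueness of their square roots\<close>

text \<open>Polarisation: \<open>\<langle>A (x + y), x + y\<rangle>\<close> and \<open>\<langle>A (x + i y), x + i y\<rangle>\<close> are real.\<close>

lemma positive_op_selfadjoint:
  assumes "positive_op A"
  shows "cinner (A x) y = cinner x (A (y::'a::complex_inner))"
proof -
  have A: "bounded_op UNIV UNIV A" using assms by (simp add: positive_op_def)
  have im: "Im (cinner (A z) z) = 0" for z
    using assms by (simp add: positive_op_def complex_nonneg_Reals_iff)
  have "cinner (A y) x = cnj (cinner x (A y))" by (metis cinner_commute)
  then show ?thesis
    using im[of "x + y"] im[of "x + \<i> *\<^sub>C y"] im[of x] im[of y]
    by (simp add: bounded_opD[OF A] cinner_linear complex_eq_iff)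
qed

text \<open>Moving from y in the direction A y, the nonnegative form starts at its minimum 0 with
  slope 2 |A y|^2, so this slope must vanish.\<close>

lemma positive_op_null:
  assumes "positive_op A" "cinner (A y) y = 0"
  shows "A y = (0::'a::complex_inner)"
proof -
  have A: "bounded_op UNIV UNIV A" using assms by (simp add: positive_op_def)
  have lin: "A (r *\<^sub>R z) = r *\<^sub>R A z" for r z
    by (simp add: scaleC_of_real[symmetric] bounded_opD[OF A])
  have pos: "0 \<le> inner (A z) z" for z
    using assms(1) by (simp add: positive_op_def complex_nonneg_Reals_iff Re_cinner)
  have sym: "inner (A u) v = inner u (A v)" for u v
    using positive_op_selfadjoint[OF assms(1), of u v] by (metis Re_cinner)
  have y: "inner (A y) y = 0" using assms(2) by (metis Re_cinner zero_complex.simps(1))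
  have "0 \<le> t\<^sup>2 * inner (A (A y)) (A y) + t * (2 * inner (A y) (A y))" for t
    using pos[of "y + t *\<^sub>R A y"] sym[of "A y" y] y
    by (simp add: bounded_opD(2)[OF A] lin inner_simps power2_eq_square algebra_simps)
  from quadratic_linear_zero[OF this] show ?thesis by simp
qed

text \<open>For y = (P - Q) x commutation gives (P + Q) y = (P^2 - Q^2) x = 0. Two nonnegative forms
  with sum 0 at y both vanish there, so P y = Q y = 0, and |y|^2 is the inner product of x with (P -
  Q) y.\<close>

lemma positive_sqrt_unique:
  fixes P Q :: "'a::complex_inner \<Rightarrow> 'a"
  assumes P: "positive_op P" and Q: "positive_op Q"
    and sq: "\<And>x. P (P x) = Q (Q x)" and comm: "\<And>x. P (Q x) = Q (P x)"
  shows "P x = Q x"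
proof -
  have bP: "bounded_op UNIV UNIV P" and bQ: "bounded_op UNIV UNIV Q"
    using P Q by (simp_all add: positive_op_def)
  note diff = bounded_op_diff[OF csubspace_UNIV bP] bounded_op_diff[OF csubspace_UNIV bQ]
  define y where "y = P x - Q x"
  have "P y + Q y = 0"
    by (simp add: y_def diff sq comm)
  then have "cinner (P y) y + cinner (Q y) y = 0"
    by (simp add: cinner_add_left[symmetric] cinner_zero_left)
  moreover have "cinner (P y) y \<in> \<real>\<^sub>\<ge>\<^sub>0" "cinner (Q y) y \<in> \<real>\<^sub>\<ge>\<^sub>0"
    using P Q by (simp_all add: positive_op_def)
  ultimately have "cinner (P y) y = 0" "cinner (Q y) y = 0"
    by (auto simp: complex_nonneg_Reals_iff complex_eq_iff)
  then have "P y = 0" "Q y = 0"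
    using positive_op_null P Q by blast+
  moreover have "cinner y y = cinner x (P y) - cinner x (Q y)"
    by (subst (1) y_def)
      (simp add: cinner_diff_left positive_op_selfadjoint[OF P] positive_op_selfadjoint[OF Q])
  ultimately have "cinner y y = 0" by simp
  then show ?thesis by (simp add: cinner_self y_def)
qed

lemma sqrt_op_eq_series:
  fixes B :: "'a::chilbert_space \<Rightarrow> 'a"
  assumes B: "bounded_op UNIV UNIV B" and contr: "\<And>x. norm (B x) \<le> norm x"
    and sa: "\<And>x y. cinner (B x) y = cinner x (B y)"
  shows "sqrt_op (\<lambda>x. x - B x) = sqrt_series B"
  unfolding sqrt_op_def
proof (rule the_equality)
  show "positive_op (sqrt_series B) \<and> sqrt_series B \<circ> sqrt_series B = (\<lambda>x. x - B x)"
    using positive_sqrt_series[OF B contr sa] sqrt_series_square[OF B contr] by auto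
next
  fix Q assume Q: "positive_op Q \<and> Q \<circ> Q = (\<lambda>x. x - B x)"
  then have "Q \<circ> Q = (\<lambda>x. x - B x)" ..
  then have "(Q \<circ> Q) x = x - B x" for x by (rule fun_cong)
  then have QQ: "Q (Q x) = x - B x" for x unfolding comp_apply .
  have bQ: "bounded_op UNIV UNIV Q" using Q by (simp add: positive_op_def)
  \<comment> \<open>Q commutes with its own square 1 - B, hence with B, hence with the series in
    B.\<close>
  have "Q (x - B x) = Q x - B (Q x)" for x
    using QQ[of "Q x"] unfolding QQ[of x] .
  then have "Q (B x) = B (Q x)" for x
    using bounded_op_diff[OF csubspace_UNIV bQ, of x "B x"] by simp
  then have comm: "Q (sqrt_series B x) = sqrt_series B (Q x)" for x
    by (rule sqrt_series_commute[OF B contr bQ])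
  show "Q = sqrt_series B"
  proof (rule ext, rule positive_sqrt_unique[of Q "sqrt_series B"])
    show "positive_op Q" using Q ..
    show "positive_op (sqrt_series B)" by (rule positive_sqrt_series[OF B contr sa])
    show "Q (Q x) = sqrt_series B (sqrt_series B x)" for x
      by (simp only: QQ sqrt_series_square[OF B contr])
    show "Q (sqrt_series B x) = sqrt_series B (Q x)" for x by (rule comm)
  qed
qed

text \<open>T* T is a self-adjoint contraction, so the series computes \<open>defect_op T\<close>.
  From here on the series is out of sight: the defect operator enters only through positivity and
  the value of its square.\<close>

lemma
  fixes T :: "'a::chilbert_space \<Rightarrow> 'a"
  assumes "contraction_op T"
  shows positive_defect_op: "positive_op (defect_op T)"
    and defect_op_square: "defect_op T (defect_op T x) = x - adj UNIV T (T x)"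
proof -
  have T: "bounded_op UNIV UNIV T" and le: "norm (T x) \<le> 1 * norm x" for x
    using assms by (simp_all add: contraction_op_def)
  have B: "bounded_op UNIV UNIV (\<lambda>x. adj UNIV T (T x))"
    by (rule bounded_op_compose[OF bounded_op_adj[OF closed_csubspace_UNIV T] T])
  have contr: "norm (adj UNIV T (T x)) \<le> norm x" for x
    using norm_adj_le[OF closed_csubspace_UNIV T le, of "T x"] le[of x] by simp
  have sa: "cinner (adj UNIV T (T x)) y = cinner x (adj UNIV T (T y))" for x y
    by (simp add: cinner_adj_left[OF closed_csubspace_UNIV T] cinner_adj_right[OF closed_csubspace_UNIV T])
  have "defect_op T = sqrt_series (\<lambda>x. adj UNIV T (T x))"
    unfolding defect_op_def by (rule sqrt_op_eq_series[OF B contr sa])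
  then show "positive_op (defect_op T)" "defect_op T (defect_op T x) = x - adj UNIV T (T x)"
    using positive_sqrt_series[OF B contr sa] sqrt_series_square[OF B contr] by auto
qed

lemma bounded_op_defect:
  "contraction_op (T :: 'a::chilbert_space \<Rightarrow> 'a) \<Longrightarrow> bounded_op UNIV UNIV (defect_op T)"
  using positive_defect_op[of T] by (simp add: positive_op_def)

lemma cinner_defect_op:
  "contraction_op T \<Longrightarrow> cinner (defect_op T x) y = cinner x (defect_op T (y::'a::chilbert_space))"
  by (rule positive_op_selfadjoint[OF positive_defect_op])

text \<open>The reason why \<open>V_last T\<close> is isometric: replacing h by the pair (T h, D h)
  preserves the norm.\<close>

lemma norm_defect_op:
  fixes T :: "'a::chilbert_space \<Rightarrow> 'a"
  assumes "contraction_op T"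
  shows "(norm (T x))\<^sup>2 + (norm (defect_op T x))\<^sup>2 = (norm x)\<^sup>2"
proof -
  have T: "bounded_op UNIV UNIV T" using assms by (simp add: contraction_op_def)
  have "complex_of_real ((norm (defect_op T x))\<^sup>2) = cinner x (x - adj UNIV T (T x))"
    using cinner_defect_op[OF assms, of x "defect_op T x"]
    by (simp only: cinner_self defect_op_square[OF assms])
  also have "\<dots> = complex_of_real ((norm x)\<^sup>2 - (norm (T x))\<^sup>2)"
    by (simp add: cinner_linear cinner_adj_right[OF closed_csubspace_UNIV T] cinner_self)
  finally have "(norm (defect_op T x))\<^sup>2 = (norm x)\<^sup>2 - (norm (T x))\<^sup>2"
    by (rule of_real_eq_iff[THEN iffD1])
  then show ?thesis by simp
qed

lemma defect_op_in: "defect_op T x \<in> defect_space T"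
  unfolding defect_space_def by (rule subsetD[OF closure_subset rangeI])

lemma closed_csubspace_defect_space:
  assumes "contraction_op (T :: 'a::chilbert_space \<Rightarrow> 'a)"
  shows "closed_csubspace (defect_space T)"
proof -
  note D = bounded_op_defect[OF assms]
  have "csubspace (range (defect_op T))"
  proof (rule csubspaceI)
    show "0 \<in> range (defect_op T)"
      using bounded_op_zero[OF csubspace_UNIV D] rangeI[of "defect_op T" 0] by simp
  next
    fix x y assume "x \<in> range (defect_op T)" "y \<in> range (defect_op T)"
    then show "x + y \<in> range (defect_op T)"
      by (auto simp: bounded_opD(2)[OF D, symmetric])
  next
    fix a x assume "x \<in> range (defect_op T)"
    then show "a *\<^sub>C x \<in> range (defect_op T)"
      by (auto simp: bounded_opD(3)[OF D, symmetric])
  qed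
  then show ?thesis
    unfolding closed_csubspace_def defect_space_def by (simp add: csubspace_closure)
qed


subsection \<open>The canonical dilation\<close>

lemma ell2_eqI: "(\<And>k. ell2_nth f k = ell2_nth g k) \<Longrightarrow> f = g"
  by (simp add: ell2_nth_inject[symmetric] fun_eq_iff)

lemma nth_Abs_ell2:
  "summable (\<lambda>k. (norm (g k))\<^sup>2) \<Longrightarrow> ell2_nth (Abs_ell2 g) = g"
  by (simp add: Abs_ell2_inverse)

lemma summable_ell2_Suc: "summable (\<lambda>k. (norm (ell2_nth f (Suc k)))\<^sup>2)"
  by (rule summable_Suc_iff[THEN iffD2, OF summable_ell2])

lemma suminf_Suc:
  fixes f :: "nat \<Rightarrow> 'a::real_normed_vector"
  shows "summable f \<Longrightarrow> suminf f = f 0 + (\<Sum>k. f (Suc k))"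
  by (simp add: suminf_split_head)

lemmas ell2_nth_simps = zero_ell2.rep_eq plus_ell2.rep_eq minus_ell2.rep_eq scaleC_ell2.rep_eq

lemma
  assumes "\<And>k. norm (g k) \<le> c * norm (ell2_nth f k)" "0 \<le> c"
  shows summable_ell2_bound: "summable (\<lambda>k. (norm (g k))\<^sup>2)"
    and norm_Abs_ell2_bound: "norm (Abs_ell2 g) \<le> c * norm f"
proof -
  have le: "(norm (g k))\<^sup>2 \<le> c\<^sup>2 * (norm (ell2_nth f k))\<^sup>2" for k
    using power_mono[OF assms(1), of k 2] by (simp add: power_mult_distrib)
  have s: "summable (\<lambda>k. c\<^sup>2 * (norm (ell2_nth f k))\<^sup>2)"
    by (intro summable_mult summable_ell2)
  show g: "summable (\<lambda>k. (norm (g k))\<^sup>2)"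
    by (rule summable_comparison_test_ev[OF _ s]) (simp add: le)
  have "(norm (Abs_ell2 g))\<^sup>2 \<le> (\<Sum>k. c\<^sup>2 * (norm (ell2_nth f k))\<^sup>2)"
    unfolding norm_ell2_sq nth_Abs_ell2[OF g] by (rule suminf_le[OF le g s])
  also have "\<dots> = (c * norm f)\<^sup>2"
    by (simp add: suminf_mult[OF summable_ell2] norm_ell2_sq[symmetric] power_mult_distrib)
  finally show "norm (Abs_ell2 g) \<le> c * norm f"
    by (rule power2_le_imp_le) (simp add: assms(2))
qed

text \<open>For sequences such as \<open>fund_sub\<close>, whose entry k + 1 is controlled by entry
  k of f. Dropping the zero in front changes neither summability nor the norm.\<close>

lemma
  assumes "g 0 = 0" "\<And>k. norm (g (Suc k)) \<le> c * norm (ell2_nth f k)" "0 \<le> c"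
  shows summable_ell2_shift_bound: "summable (\<lambda>k. (norm (g k))\<^sup>2)"
    and norm_Abs_ell2_shift_bound: "norm (Abs_ell2 g) \<le> c * norm f"
proof -
  note b = summable_ell2_bound[OF assms(2,3)] norm_Abs_ell2_bound[OF assms(2,3)]
  show s: "summable (\<lambda>k. (norm (g k))\<^sup>2)"
    using b(1) by (subst summable_Suc_iff[symmetric])
  have "(norm (Abs_ell2 g))\<^sup>2 = (norm (Abs_ell2 (\<lambda>k. g (Suc k))))\<^sup>2"
    unfolding norm_ell2_sq nth_Abs_ell2[OF s] nth_Abs_ell2[OF b(1)] suminf_Suc[OF s]
    by (simp add: assms(1))
  then show "norm (Abs_ell2 g) \<le> c * norm f"
    using b(2) by (simp add: power2_eq_iff_nonneg)
qed

definition ell2_single :: "nat \<Rightarrow> 'a::complex_inner \<Rightarrow> 'a ell2" where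
  "ell2_single k x = Abs_ell2 (\<lambda>j. if j = k then x else 0)"

lemma nth_ell2_single: "ell2_nth (ell2_single k x) j = (if j = k then x else 0)"
proof -
  have "summable (\<lambda>j. (norm (if j = k then x else 0))\<^sup>2)"
    by (rule summable_finite[of "{k}"]) auto
  then show ?thesis by (simp add: ell2_single_def nth_Abs_ell2)
qed

lemma embed0_eq_single: "embed0 = ell2_single 0"
  by (simp add: fun_eq_iff embed0_def ell2_single_def)

lemma cinner_ell2_single: "cinner (ell2_single k x) f = cinner x (ell2_nth f k)"
proof -
  have "cinner (ell2_single k x) f = (\<Sum>j\<in>{k}. cinner (ell2_nth (ell2_single k x) j) (ell2_nth f j))"
    unfolding cinner_ell2_def
    by (rule suminf_finite) (auto simp: nth_ell2_single cinner_zero_left)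
  then show ?thesis by (simp add: nth_ell2_single)
qed

lemma cinner_ell2_single_right: "cinner f (ell2_single k x) = cinner (ell2_nth f k) x"
  by (subst cinner_commute) (simp add: cinner_ell2_single cinner_commute[symmetric])

lemma isometry_ell2_single:
  assumes "\<And>x. x \<in> M \<Longrightarrow> ell2_single k x \<in> L"
  shows "isometry_op M L (ell2_single k)"
proof -
  have "norm (ell2_single k x) = norm x" for x :: 'a
  proof -
    have "complex_of_real ((norm (ell2_single k x))\<^sup>2) = complex_of_real ((norm x)\<^sup>2)"
      unfolding cinner_self[symmetric] by (simp add: cinner_ell2_single nth_ell2_single)
    then have "(norm (ell2_single k x))\<^sup>2 = (norm x)\<^sup>2" by (rule of_real_eq_iff[THEN iffD1])
    then show ?thesis by (simp add: power2_eq_iff_nonneg)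
  qed
  moreover have "ell2_single k (x + y) = ell2_single k x + ell2_single k y" for x y :: 'a
    by (rule ell2_eqI) (simp add: nth_ell2_single ell2_nth_simps)
  moreover have "ell2_single k (c *\<^sub>C x) = c *\<^sub>C ell2_single k x" for c and x :: 'a
    by (rule ell2_eqI) (simp add: nth_ell2_single ell2_nth_simps scaleC_zero_right)
  ultimately show ?thesis
    using assms unfolding isometry_op_def bounded_op_def by (auto intro!: exI[of _ 1])
qed

lemma bounded_op_ell2_single: "bounded_op UNIV UNIV (ell2_single k)"
  by (rule isometry_ell2_single[OF UNIV_I, unfolded isometry_op_def, THEN conjunct1])

lemma nth_V_last:
  "ell2_nth (V_last T f) = (\<lambda>k. case k of 0 \<Rightarrow> T (ell2_nth f 0)
     | Suc 0 \<Rightarrow> defect_op T (ell2_nth f 0) | Suc (Suc j) \<Rightarrow> ell2_nth f (Suc j))"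
proof -
  define g where "g = (\<lambda>k. case k of 0 \<Rightarrow> T (ell2_nth f 0)
     | Suc 0 \<Rightarrow> defect_op T (ell2_nth f 0) | Suc (Suc j) \<Rightarrow> ell2_nth f (Suc j))"
  have "summable (\<lambda>k. (norm (g (Suc (Suc k))))\<^sup>2)"
    using summable_ell2_Suc[of f] by (simp add: g_def)
  then have "summable (\<lambda>k. (norm (g k))\<^sup>2)"
    using summable_Suc_iff[of "\<lambda>k. (norm (g k))\<^sup>2"] summable_Suc_iff[of "\<lambda>k. (norm (g (Suc k)))\<^sup>2"]
    by simp
  from nth_Abs_ell2[OF this] show ?thesis
    by (simp add: V_last_def g_def)
qed

section \<open>The space \<open>K0 T\<close> and the isometry \<open>V_last T\<close>\<close>

context
  fixes T :: "'a::chilbert_space \<Rightarrow> 'a"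
  assumes contr: "contraction_op T"
begin

lemma closed_csubspace_K0: "closed_csubspace (K0 T)"
proof -
  have M: "csubspace (defect_space T)" "closed (defect_space T)"
    using closed_csubspace_defect_space[OF contr] by (simp_all add: closed_csubspace_def)
  have "csubspace (K0 T)"
    by (rule csubspaceI) (simp_all add: K0_def ell2_nth_simps csubspaceD(1-3)[OF M(1)])
  moreover have "closed (K0 T)"
    unfolding closed_sequential_limits
  proof (intro allI impI)
    fix f l assume f: "(\<forall>n. f n \<in> K0 T) \<and> f \<longlonglongrightarrow> l"
    have "ell2_nth l k \<in> defect_space T" if "k \<ge> 1" for k
    proof (rule closed_sequentially[OF M(2)])
      show "ell2_nth (f n) k \<in> defect_space T" for n
        using f that by (simp add: K0_def)
      have "(\<lambda>n. ell2_nth (f n) k - ell2_nth l k) \<longlonglongrightarrow> 0"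
      proof (rule Lim_null_comparison)
        show "\<forall>\<^sub>F n in sequentially. norm (ell2_nth (f n) k - ell2_nth l k) \<le> norm (f n - l)"
          using norm_nth_le_ell2[of "f _ - l" k] by (simp add: ell2_nth_simps)
        show "(\<lambda>n. norm (f n - l)) \<longlonglongrightarrow> 0"
          using f by (simp add: LIM_zero_iff tendsto_norm_zero)
      qed
      then show "(\<lambda>n. ell2_nth (f n) k) \<longlonglongrightarrow> ell2_nth l k" by (simp add: LIM_zero_iff)
    qed
    then show "l \<in> K0 T" by (simp add: K0_def)
  qed
  ultimately show ?thesis by (simp add: closed_csubspace_def)
qed

lemma csubspace_K0: "csubspace (K0 T)"
  using closed_csubspace_K0 by (simp add: closed_csubspace_def)

lemma zero_in_defect_space: "0 \<in> defect_space T"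
  using csubspaceD(1)[of "defect_space T"] closed_csubspace_defect_space[OF contr]
  by (simp add: closed_csubspace_def)

lemma embed0_in_K0: "embed0 h \<in> K0 T"
  by (simp add: K0_def embed0_eq_single nth_ell2_single zero_in_defect_space)

lemma isometry_embed0: "isometry_op UNIV (K0 T) embed0"
  using isometry_ell2_single[of UNIV 0 "K0 T"] embed0_in_K0 unfolding embed0_eq_single by simp

lemma isometry_V_last: "isometry_op (K0 T) (K0 T) (V_last T)"
proof -
  have T: "bounded_op UNIV UNIV T" using contr by (simp add: contraction_op_def)
  note D = bounded_op_defect[OF contr]
  have "V_last T f \<in> K0 T" if "f \<in> K0 T" for f
    using that by (auto simp: K0_def nth_V_last defect_op_in split: nat.split)
  moreover have "V_last T (f + g) = V_last T f + V_last T g" for f g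
    by (rule ell2_eqI)
      (simp add: nth_V_last ell2_nth_simps bounded_opD(2)[OF T] bounded_opD(2)[OF D] split: nat.split)
  moreover have "V_last T (c *\<^sub>C f) = c *\<^sub>C V_last T f" for c f
    by (rule ell2_eqI)
      (simp add: nth_V_last ell2_nth_simps bounded_opD(3)[OF T] bounded_opD(3)[OF D] split: nat.split)
  moreover have "norm (V_last T f) = norm f" for f
  proof -
    note s = summable_ell2 summable_ell2_Suc
    have "(norm (V_last T f))\<^sup>2 = (norm (T (ell2_nth f 0)))\<^sup>2
        + ((norm (defect_op T (ell2_nth f 0)))\<^sup>2 + (\<Sum>k. (norm (ell2_nth f (Suc k)))\<^sup>2))"
      unfolding norm_ell2_sq suminf_Suc[OF s(1)[of "V_last T f"]] suminf_Suc[OF s(2)[of "V_last T f"]]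
      by (simp add: nth_V_last)
    also have "\<dots> = (norm f)\<^sup>2"
      unfolding norm_ell2_sq suminf_Suc[OF s(1)[of f]]
      using norm_defect_op[OF contr, of "ell2_nth f 0"] by simp
    finally show ?thesis by (simp add: power2_eq_iff_nonneg)
  qed
  ultimately show ?thesis
    unfolding isometry_op_def bounded_op_def by (auto intro!: exI[of _ 1])
qed

lemma bounded_op_V_last: "bounded_op (K0 T) (K0 T) (V_last T)"
  using isometry_V_last by (simp add: isometry_op_def)

text \<open>\<open>V_last T (embed0 h)\<close> is (T h, D h, 0, ...); removing entry 0 leaves D h in
  slot 1, and each further application of \<open>V_last T\<close> moves it up one slot.\<close>

lemma single_defect_eq:
  "ell2_single (Suc k) (defect_op T h)
     = (V_last T ^^ Suc k) (embed0 h) - (V_last T ^^ k) (embed0 (T h))"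
proof (induction k)
  case 0
  show ?case
    by (rule ell2_eqI)
      (simp add: embed0_eq_single nth_V_last nth_ell2_single ell2_nth_simps split: nat.split)
next
  case (Suc k)
  have D: "bounded_op UNIV UNIV T" using contr by (simp add: contraction_op_def)
  have "ell2_single (Suc (Suc k)) (defect_op T h) = V_last T (ell2_single (Suc k) (defect_op T h))"
    by (rule ell2_eqI)
      (auto simp: nth_V_last nth_ell2_single bounded_op_zero[OF csubspace_UNIV D]
        bounded_op_zero[OF csubspace_UNIV bounded_op_defect[OF contr]] split: nat.split)
  also have "\<dots> = V_last T ((V_last T ^^ Suc k) (embed0 h)) - V_last T ((V_last T ^^ k) (embed0 (T h)))"
    unfolding Suc.IH
    by (intro bounded_op_diff[OF csubspace_K0 bounded_op_V_last] funpow_in[OF bounded_op_V_last]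
        embed0_in_K0)
  finally show ?case by simp
qed

text \<open>Minimality of \<open>V_last T\<close>. The closed span contains every one-slot vector of
  \<open>K0 T\<close>: slot 0 by the generators with m = 0, higher slots on the range of D by
  \<open>single_defect_eq\<close> and then on its closure by continuity.\<close>

lemma K0_eq_closure_span: "K0 T = closure (cspan {(V_last T ^^ m) (embed0 h) |m h. True})"
  (is "_ = closure (cspan ?G)")
proof
  let ?Z = "closure (cspan ?G)"
  have Z: "closed_csubspace ?Z"
    by (simp add: closed_csubspace_def csubspace_closure cvec.subspace_span)
  have Zs: "csubspace ?Z" using Z by (simp add: closed_csubspace_def)
  have G: "(V_last T ^^ m) (embed0 h) \<in> ?Z" for m h
    by (rule subsetD[OF closure_subset], rule cvec.span_base) auto
  have "?G \<subseteq> K0 T"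
    by (auto intro: funpow_in[OF bounded_op_V_last embed0_in_K0])
  then have "cspan ?G \<subseteq> K0 T"
    using csubspace_K0 by (rule cvec.span_minimal)
  then show sub: "?Z \<subseteq> K0 T"
    using closed_csubspace_K0 by (simp add: closure_minimal closed_csubspace_def)
  have single_defect: "ell2_single (Suc k) (defect_op T h) \<in> ?Z" for k h
    unfolding single_defect_eq by (intro csubspaceD(4)[OF Zs] G)
  have single: "ell2_single (Suc k) x \<in> ?Z" if x: "x \<in> defect_space T" for k x
  proof -
    obtain y where y: "\<forall>j. y j \<in> range (defect_op T)" "y \<longlonglongrightarrow> x"
      using x unfolding defect_space_def closure_sequential by blast
    then have "\<forall>j. \<exists>h. y j = defect_op T h" by blast
    then obtain h where "\<forall>j. y j = defect_op T (h j)" by (rule choice[THEN exE])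
    then have "y = (\<lambda>j. defect_op T (h j))" by (simp add: fun_eq_iff)
    with y(2) have h: "(\<lambda>j. defect_op T (h j)) \<longlonglongrightarrow> x" by simp
    have "(\<lambda>j. ell2_single (Suc k) (defect_op T (h j))) \<longlonglongrightarrow> ell2_single (Suc k) x"
      by (rule bounded_op_tendsto[OF csubspace_UNIV bounded_op_ell2_single _ _ h]) simp_all
    then show ?thesis by (rule closed_sequentially[OF closed_closure single_defect])
  qed
  show "K0 T \<subseteq> ?Z"
  proof
    fix f assume f: "f \<in> K0 T"
    let ?p = "proj ?Z f"
    have p: "?p \<in> ?Z" by (rule proj_cinner(1)[OF Z])
    then have g: "f - ?p \<in> K0 T"
      using sub f csubspaceD(4)[OF csubspace_K0] by blast
    have orth: "cinner z (f - ?p) = 0" if "z \<in> ?Z" for z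
    proof -
      have "cinner (f - ?p) z = 0"
        using proj_cinner(2)[OF Z that, of f] by (simp add: cinner_diff_left)
      then show ?thesis using cinner_commute[of z "f - ?p"] by simp
    qed
    \<comment> \<open>The residual f - ?p is tested against its own k-th entry placed in slot k;
      orthogonality makes the norm of that entry 0.\<close>
    have "ell2_nth (f - ?p) k = 0" for k
    proof -
      have "ell2_single k (ell2_nth (f - ?p) k) \<in> ?Z"
      proof (cases k)
        case 0
        then show ?thesis
          using G[of 0 "ell2_nth (f - ?p) k"] by (simp add: embed0_eq_single)
      next
        case (Suc j)
        then show ?thesis using single g by (simp add: K0_def)
      qed
      from orth[OF this] show ?thesis
        unfolding cinner_ell2_single by (simp add: cinner_self)
    qed
    then have "f - ?p = 0"
      by (intro ell2_eqI) (simp add: ell2_nth_simps)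
    then show "f \<in> ?Z" using p by simp
  qed
qed

end

section \<open>The operators \<open>V_fund\<close> and the first claim\<close>

context
  fixes n :: nat and S X :: "nat \<Rightarrow> 'a::chilbert_space \<Rightarrow> 'a"
  assumes AY: "AY_tuple n S" and fund: "fundamental_tuple n S X"
begin

lemma contraction_Sn: "contraction_op (S n)"
  using AY by (simp add: AY_tuple_def)

lemma bounded_S: "1 \<le> i \<Longrightarrow> i \<le> n \<Longrightarrow> bounded_op UNIV UNIV (S i)"
  using AY by (simp add: AY_tuple_def)

lemma bounded_X:
  "i \<in> {1..<n} \<Longrightarrow> bounded_op (defect_space (S n)) (defect_space (S n)) (X i)"
  using fund by (simp add: fundamental_tuple_def)

text \<open>\<^term>\<open>V_fund n S X i f\<close> is the sum of these two sequences.\<close>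

definition fund_diag :: "nat \<Rightarrow> 'a ell2 \<Rightarrow> nat \<Rightarrow> 'a" where
  "fund_diag i f k = (if k = 0 then S i (ell2_nth f 0) else X i (ell2_nth f k))"

definition fund_sub :: "nat \<Rightarrow> 'a ell2 \<Rightarrow> nat \<Rightarrow> 'a" where
  "fund_sub i f k = (case k of 0 \<Rightarrow> 0
     | Suc 0 \<Rightarrow> adj (defect_space (S n)) (X (n - i)) (defect_op (S n) (ell2_nth f 0))
     | Suc (Suc j) \<Rightarrow> adj (defect_space (S n)) (X (n - i)) (ell2_nth f (Suc j)))"

text \<open>Entrywise domination supplies both the square-summability behind \<open>Abs_ell2\<close>
  and the boundedness of \<open>V_fund\<close>. The diagonal part is restricted to
  \<open>K0 (S n)\<close> because X i is controlled only on the defect space, whereas the adjoints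
  in the other part are bounded everywhere.\<close>

lemma fund_parts_bounds:
  assumes i: "i \<in> {1..<n}"
  shows "\<exists>c\<ge>0. (\<forall>f\<in>K0 (S n). \<forall>k. norm (fund_diag i f k) \<le> c * norm (ell2_nth f k))
    \<and> (\<forall>f k. norm (fund_sub i f (Suc k)) \<le> c * norm (ell2_nth f k))"
proof -
  have i': "n - i \<in> {1..<n}" using i by auto
  obtain a where a: "0 \<le> a" "\<And>x. norm (S i x) \<le> a * norm x"
    using bounded_op_bound[OF bounded_S[of i]] i by auto
  obtain b where b: "0 \<le> b" "\<And>x. x \<in> defect_space (S n) \<Longrightarrow> norm (X i x) \<le> b * norm x"
    using bounded_op_bound[OF bounded_X[OF i]] by blast
  obtain d where d: "0 \<le> d" "\<And>x. norm (adj (defect_space (S n)) (X (n - i)) x) \<le> d * norm x"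
    using bounded_op_bound[OF bounded_op_adj[OF closed_csubspace_defect_space[OF contraction_Sn]
          bounded_X[OF i']]] by auto
  have D: "norm (defect_op (S n) x) \<le> norm x" for x
  proof (rule power2_le_imp_le)
    show "(norm (defect_op (S n) x))\<^sup>2 \<le> (norm x)\<^sup>2"
      unfolding norm_defect_op[OF contraction_Sn, of x, symmetric] by simp
  qed simp
  define c where "c = a + b + d"
  have c: "a * norm x \<le> c * norm x" "b * norm x \<le> c * norm x" "d * norm x \<le> c * norm x" for x :: 'a
    using a(1) b(1) d(1) by (auto simp: c_def intro!: mult_right_mono)
  show ?thesis
  proof (intro exI[of _ c] conjI ballI allI)
    show "0 \<le> c" using a(1) b(1) d(1) by (simp add: c_def)
    show "norm (fund_diag i f k) \<le> c * norm (ell2_nth f k)" if "f \<in> K0 (S n)" for f k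
      using that order_trans[OF a(2)[of "ell2_nth f 0"] c(1)]
        order_trans[OF b(2)[of "ell2_nth f k"] c(2)]
      by (simp add: fund_diag_def K0_def)
    show "norm (fund_sub i f (Suc k)) \<le> c * norm (ell2_nth f k)" for f k
    proof (cases k)
      case 0
      have "norm (fund_sub i f (Suc k)) \<le> d * norm (defect_op (S n) (ell2_nth f 0))"
        using d(2) by (simp add: fund_sub_def 0)
      also have "\<dots> \<le> d * norm (ell2_nth f 0)" by (intro mult_left_mono D d(1))
      also have "\<dots> \<le> c * norm (ell2_nth f 0)" by (rule c(3))
      finally show ?thesis using 0 by simp
    next
      case (Suc j)
      then show ?thesis
        using order_trans[OF d(2)[of "ell2_nth f k"] c(3)] by (simp add: fund_sub_def)
    qed
  qed
qed

lemma V_fund_eq_sum: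
  assumes i: "i \<in> {1..<n}" and f: "f \<in> K0 (S n)"
  shows "ell2_nth (Abs_ell2 (fund_diag i f)) = fund_diag i f"
    "ell2_nth (Abs_ell2 (fund_sub i f)) = fund_sub i f"
    "V_fund n S X i f = Abs_ell2 (fund_diag i f) + Abs_ell2 (fund_sub i f)"
    "ell2_nth (V_fund n S X i f) k = fund_diag i f k + fund_sub i f k"
proof -
  obtain c where c: "0 \<le> c"
    "\<And>f k. f \<in> K0 (S n) \<Longrightarrow> norm (fund_diag i f k) \<le> c * norm (ell2_nth f k)"
    "\<And>f k. norm (fund_sub i f (Suc k)) \<le> c * norm (ell2_nth f k)"
    using fund_parts_bounds[OF i] by blast
  have sub0: "fund_sub i f 0 = 0" by (simp add: fund_sub_def)
  show nth: "ell2_nth (Abs_ell2 (fund_diag i f)) = fund_diag i f"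
    "ell2_nth (Abs_ell2 (fund_sub i f)) = fund_sub i f"
    using nth_Abs_ell2[OF summable_ell2_bound[OF c(2)[OF f] c(1)]]
      nth_Abs_ell2[OF summable_ell2_shift_bound[OF sub0 c(3,1)]] by auto
  have "V_fund n S X i f = Abs_ell2 (\<lambda>k. fund_diag i f k + fund_sub i f k)"
    unfolding V_fund_def
    by (rule arg_cong[of _ _ Abs_ell2])
      (auto simp: fun_eq_iff fund_diag_def fund_sub_def split: nat.split)
  also have "\<dots> = Abs_ell2 (ell2_nth (Abs_ell2 (fund_diag i f) + Abs_ell2 (fund_sub i f)))"
    by (simp add: ell2_nth_simps nth)
  finally show eq: "V_fund n S X i f = Abs_ell2 (fund_diag i f) + Abs_ell2 (fund_sub i f)"
    by (simp add: ell2_nth_inverse)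
  show "ell2_nth (V_fund n S X i f) k = fund_diag i f k + fund_sub i f k"
    by (simp add: eq ell2_nth_simps nth)
qed

lemma bounded_op_V_fund:
  assumes i: "i \<in> {1..<n}"
  shows "bounded_op (K0 (S n)) (K0 (S n)) (V_fund n S X i)"
proof -
  have i': "n - i \<in> {1..<n}" using i by auto
  note M = closed_csubspace_defect_space[OF contraction_Sn]
  have Ms: "csubspace (defect_space (S n))" using M by (simp add: closed_csubspace_def)
  note A = bounded_op_adj[OF M bounded_X[OF i']]
  note D = bounded_op_defect[OF contraction_Sn]
  have Si: "bounded_op UNIV UNIV (S i)" using bounded_S[of i] i by simp
  note K = csubspaceD[OF csubspace_K0[OF contraction_Sn]]
  obtain c where c: "0 \<le> c"
    "\<And>f k. f \<in> K0 (S n) \<Longrightarrow> norm (fund_diag i f k) \<le> c * norm (ell2_nth f k)"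
    "\<And>f k. norm (fund_sub i f (Suc k)) \<le> c * norm (ell2_nth f k)"
    using fund_parts_bounds[OF i] by blast
  have "V_fund n S X i f \<in> K0 (S n)" if "f \<in> K0 (S n)" for f
    using that unfolding K0_def
    by (auto simp: V_fund_eq_sum(4)[OF i that] fund_diag_def fund_sub_def split: nat.split
        intro!: csubspaceD(2)[OF Ms] bounded_opD(1)[OF bounded_X[OF i]] bounded_opD(1)[OF A])
  moreover have "V_fund n S X i (f + g) = V_fund n S X i f + V_fund n S X i g"
    if "f \<in> K0 (S n)" "g \<in> K0 (S n)" for f g
  proof (rule ell2_eqI)
    fix k
    have "fund_diag i (f + g) k = fund_diag i f k + fund_diag i g k"
      using that by (simp add: fund_diag_def ell2_nth_simps bounded_opD(2)[OF Si]
          bounded_opD(2)[OF bounded_X[OF i]] K0_def)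
    moreover have "fund_sub i (f + g) k = fund_sub i f k + fund_sub i g k"
      by (simp add: fund_sub_def ell2_nth_simps bounded_opD(2)[OF D] bounded_opD(2)[OF A]
          split: nat.split)
    ultimately show "ell2_nth (V_fund n S X i (f + g)) k = ell2_nth (V_fund n S X i f + V_fund n S X i g) k"
      using that K(2)[OF that] by (simp add: ell2_nth_simps V_fund_eq_sum(4)[OF i])
  qed
  moreover have "V_fund n S X i (a *\<^sub>C f) = a *\<^sub>C V_fund n S X i f" if "f \<in> K0 (S n)" for a f
  proof (rule ell2_eqI)
    fix k
    have "fund_diag i (a *\<^sub>C f) k = a *\<^sub>C fund_diag i f k"
      using that by (simp add: fund_diag_def ell2_nth_simps bounded_opD(3)[OF Si]
          bounded_opD(3)[OF bounded_X[OF i]] K0_def)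
    moreover have "fund_sub i (a *\<^sub>C f) k = a *\<^sub>C fund_sub i f k"
      by (simp add: fund_sub_def ell2_nth_simps bounded_opD(3)[OF D] bounded_opD(3)[OF A]
          scaleC_zero_right split: nat.split)
    ultimately show "ell2_nth (V_fund n S X i (a *\<^sub>C f)) k = ell2_nth (a *\<^sub>C V_fund n S X i f) k"
      using that K(3)[OF that] by (simp add: ell2_nth_simps V_fund_eq_sum(4)[OF i] scaleC_add_right)
  qed
  moreover have "norm (V_fund n S X i f) \<le> (2 * c) * norm f" if f: "f \<in> K0 (S n)" for f
  proof -
    have sub0: "fund_sub i f 0 = 0" by (simp add: fund_sub_def)
    have "norm (V_fund n S X i f) \<le> norm (Abs_ell2 (fund_diag i f)) + norm (Abs_ell2 (fund_sub i f))"
      unfolding V_fund_eq_sum(3)[OF i f] by (rule norm_triangle_ineq)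
    also have "\<dots> \<le> c * norm f + c * norm f"
      by (intro add_mono norm_Abs_ell2_bound[OF c(2)[OF f] c(1)]
          norm_Abs_ell2_shift_bound[OF sub0 c(3,1)])
    finally show ?thesis by simp
  qed
  ultimately show ?thesis unfolding bounded_op_def by blast
qed

text \<open>The adjoint relation in weak form. The right side splits into a diagonal series p and a
  subdiagonal series q; the left side has entries p 0 - w, w + q 1, p 1 + q 2, p 2 + q 3 and so on.
  Hence the two sums agree once w cancels and p is shifted by one.\<close>

lemma cinner_V_fund_V_last:
  assumes i: "i \<in> {1..<n}" and z: "z \<in> K0 (S n)" and x: "x \<in> K0 (S n)"
  shows "cinner (V_fund n S X (n - i) z) (V_last (S n) x) = cinner z (V_fund n S X i x)"
proof -
  have i': "n - i \<in> {1..<n}" and ii: "n - (n - i) = i" using i by auto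
  note M = closed_csubspace_defect_space[OF contraction_Sn]
  have zk: "ell2_nth z (Suc k) \<in> defect_space (S n)" and xk: "ell2_nth x (Suc k) \<in> defect_space (S n)" for k
    using z x by (simp_all add: K0_def)
  have S': "bounded_op UNIV UNIV (S (n - i))" using bounded_S[of "n - i"] i by auto
  define p where "p k = cinner (ell2_nth z k) (fund_diag i x k)" for k
  define q where "q k = cinner (ell2_nth z k) (fund_sub i x k)" for k
  \<comment> \<open>By the fundamental equation w is what entry 0 of the left side lacks. Entry 1
    returns it, as the pairing of \<open>X i\<close> adjoint applied to D z0 with D x0, where z0 and
    x0 are the entries 0 of z and x.\<close>
  define w where "w = cinner (ell2_nth z 0)
    (defect_op (S n) (X i (defect_op (S n) (ell2_nth x 0))))"
  define l where "l k = cinner (ell2_nth (V_fund n S X (n - i) z) k) (ell2_nth (V_last (S n) x) k)" for k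
  have sp: "summable p" and sq: "summable q"
    using summable_cinner_ell2[of z "Abs_ell2 (fund_diag i x)"]
      summable_cinner_ell2[of z "Abs_ell2 (fund_sub i x)"]
    unfolding V_fund_eq_sum(1,2)[OF i x] p_def[symmetric] q_def[symmetric] .
  have sl: "summable l"
    unfolding l_def by (rule summable_cinner_ell2)
  have "l 0 = cinner (ell2_nth z 0) (adj UNIV (S (n - i)) (S n (ell2_nth x 0)))"
    by (simp add: l_def V_fund_eq_sum(4)[OF i' z] nth_V_last fund_diag_def fund_sub_def
        cinner_adj_right[OF closed_csubspace_UNIV S'])
  also have "\<dots> = cinner (ell2_nth z 0) (S i (ell2_nth x 0)
      - defect_op (S n) (X i (defect_op (S n) (ell2_nth x 0))))"
  proof -
    have "S i h - adj UNIV (S (n - i)) (S n h) = defect_op (S n) (X i (defect_op (S n) h))" for h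
      using fund i by (simp add: fundamental_tuple_def)
    from this[of "ell2_nth x 0", symmetric] show ?thesis by simp
  qed
  finally have l0: "l 0 = p 0 - w"
    by (simp add: cinner_diff_right p_def w_def fund_diag_def)
  have adjX: "cinner (adj (defect_space (S n)) (X i) u) v = cinner u (X i v)"
    if "v \<in> defect_space (S n)" for u v
    by (rule cinner_adj_left[OF M bounded_X[OF i] that])
  have adjX': "cinner v (adj (defect_space (S n)) (X (n - i)) u) = cinner (X (n - i) v) u"
    if "v \<in> defect_space (S n)" for u v
    by (rule cinner_adj_right[OF M bounded_X[OF i'] that])
  have l1: "l 1 = w + q 1"
    using zk[of 0]
    by (simp add: l_def q_def w_def V_fund_eq_sum(4)[OF i' z] nth_V_last fund_diag_def fund_sub_def ii
        cinner_linear adjX adjX' defect_op_in cinner_defect_op[OF contraction_Sn])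
  have l2: "l (Suc (Suc k)) = p (Suc k) + q (Suc (Suc k))" for k
    using zk[of "Suc k"] xk[of k]
    by (simp add: l_def q_def p_def V_fund_eq_sum(4)[OF i' z] nth_V_last fund_diag_def fund_sub_def ii
        cinner_linear adjX adjX')
  have s1: "summable (\<lambda>k. p (Suc k))" "summable (\<lambda>k. q (Suc k))" "summable (\<lambda>k. q (Suc (Suc k)))"
    "summable (\<lambda>k. l (Suc k))"
    using sp sq sl summable_Suc_iff[of p] summable_Suc_iff[of q] summable_Suc_iff[of l]
      summable_Suc_iff[of "\<lambda>k. q (Suc k)"] by simp_all
  have "q 0 = 0" by (simp add: q_def fund_sub_def cinner_zero_right)
  have "suminf l = l 0 + (l 1 + (\<Sum>k. p (Suc k) + q (Suc (Suc k))))"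
    using suminf_Suc[OF sl] suminf_Suc[OF s1(4)] by (simp add: l2)
  also have "\<dots> = p 0 + (\<Sum>k. p (Suc k)) + (q 0 + (q 1 + (\<Sum>k. q (Suc (Suc k)))))"
    using suminf_add[OF s1(1,3)] l0 l1 \<open>q 0 = 0\<close> by simp
  also have "\<dots> = suminf p + suminf q"
    using suminf_Suc[OF sp] suminf_Suc[OF sq] suminf_Suc[OF s1(2)] by simp
  also have "\<dots> = (\<Sum>k. p k + q k)" by (rule suminf_add[OF sp sq])
  also have "\<dots> = cinner z (V_fund n S X i x)"
    unfolding cinner_ell2_def V_fund_eq_sum(4)[OF i x] by (simp add: p_def q_def cinner_add_right)
  finally show ?thesis unfolding l_def cinner_ell2_def .
qed

lemma bounded_op_V_tuple:
  assumes "i \<in> {1..n}"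
  shows "bounded_op (K0 (S n)) (K0 (S n)) (V_tuple n S X i)"
  using assms bounded_op_V_fund[of i] bounded_op_V_last[OF contraction_Sn]
  by (auto simp: V_tuple_def)

lemma AY_isometry_V_tuple: "AY_isometry n (K0 (S n)) (V_tuple n S X)"
proof -
  have "V_fund n S X i x = adj (K0 (S n)) (V_fund n S X (n - i)) (V_last (S n) x)"
    if "i \<in> {1..<n}" "x \<in> K0 (S n)" for i x
    using bounded_opD(1)[OF bounded_op_V_fund[OF that(1)] that(2)] cinner_V_fund_V_last[OF that(1) _ that(2)]
    by (intro adj_eqI[symmetric] csubspace_K0 contraction_Sn) auto
  then show ?thesis
    using bounded_op_V_tuple isometry_V_last[OF contraction_Sn]
    by (auto simp: AY_isometry_def V_tuple_def)
qed

text \<open>Entry 0 evolves by S alone. In weak form this says that the adjoints preserve the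
  embedded space, and along words it is the dilation property.\<close>

lemma nth_0_V_tuple:
  assumes "i \<in> {1..n}" "f \<in> K0 (S n)"
  shows "ell2_nth (V_tuple n S X i f) 0 = S i (ell2_nth f 0)"
proof (cases "i = n")
  case False
  then have "i \<in> {1..<n}" using assms by auto
  from V_fund_eq_sum(4)[OF this assms(2)] show ?thesis
    using False by (simp add: V_tuple_def fund_diag_def fund_sub_def)
qed (simp add: V_tuple_def nth_V_last)

lemma coinvariant_V_tuple: "coinvariant n (K0 (S n)) (range embed0) (V_tuple n S X)"
proof -
  have "adj (K0 (S n)) (V_tuple n S X i) (embed0 h) = embed0 (adj UNIV (S i) h)" if i: "i \<in> {1..n}" for i h
  proof (rule adj_eqI)
    have Si: "bounded_op UNIV UNIV (S i)" using bounded_S[of i] i by simp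
    show "cinner (V_tuple n S X i z) (embed0 h) = cinner z (embed0 (adj UNIV (S i) h))"
      if "z \<in> K0 (S n)" for z
      unfolding embed0_eq_single cinner_ell2_single_right nth_0_V_tuple[OF i that]
      by (simp add: cinner_adj_right[OF closed_csubspace_UNIV Si])
  qed (simp_all add: csubspace_K0 contraction_Sn embed0_in_K0)
  then show ?thesis
    unfolding coinvariant_def using embed0_in_K0[OF contraction_Sn] by auto
qed

lemma AY_isometric_dilation_V_tuple: "AY_isometric_dilation n (K0 (S n)) embed0 (V_tuple n S X) S"
proof -
  have fold: "foldr (V_tuple n S X) w f \<in> K0 (S n)
      \<and> ell2_nth (foldr (V_tuple n S X) w f) 0 = foldr S w (ell2_nth f 0)"
    if "set w \<subseteq> {1..n}" "f \<in> K0 (S n)" for w f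
    using that
  proof (induction w)
    case (Cons i w)
    then show ?case
      using bounded_opD(1)[OF bounded_op_V_tuple[of i]] nth_0_V_tuple[of i] by simp
  qed simp
  have lin: "bounded_op UNIV UNIV (embed0 :: 'a \<Rightarrow> 'a ell2)"
    unfolding embed0_eq_single by (rule bounded_op_ell2_single)
  have sub: "csubspace (range (embed0 :: 'a \<Rightarrow> 'a ell2))"
  proof (rule csubspaceI)
    have "embed0 (0::'a) = 0" by (rule bounded_op_zero[OF csubspace_UNIV lin])
    then show "0 \<in> range (embed0 :: 'a \<Rightarrow> 'a ell2)" by (metis rangeI)
  qed (auto simp: bounded_opD(2,3)[OF lin, symmetric])
  have "embed0 (foldr S w h) = proj (range embed0) (foldr (V_tuple n S X) w (embed0 h))"
    if "set w \<subseteq> {1..n}" for w h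
  proof (rule proj_eqI[OF sub, symmetric])
    show "cinner (foldr (V_tuple n S X) w (embed0 h)) z = cinner (embed0 (foldr S w h)) z"
      if "z \<in> range embed0" for z
      using that fold[OF \<open>set w \<subseteq> {1..n}\<close> embed0_in_K0[OF contraction_Sn], of h]
      by (auto simp: embed0_eq_single cinner_ell2_single_right nth_ell2_single)
  qed simp
  then show ?thesis
    unfolding AY_isometric_dilation_def dilation_def
    using closed_csubspace_K0[OF contraction_Sn] isometry_embed0[OF contraction_Sn]
      bounded_op_V_tuple AY_isometry_V_tuple by blast
qed

end


subsection \<open>Operators and unitaries determined by inner products\<close>

text \<open>Polarisation preserves the real inner product; applying this to i x as well takes care
  of the imaginary part.\<close>

lemma isometry_cinner:
  assumes M: "csubspace M" and T: "isometry_op M N T" and x: "x \<in> M" and y: "y \<in> M"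
  shows "cinner (T x) (T y) = cinner x y"
proof -
  have b: "bounded_op M N T" and nrm: "norm (T u) = norm u" if "u \<in> M" for u
    using T that by (auto simp: isometry_op_def)
  have inner: "inner (T u) (T v) = inner u v" if u: "u \<in> M" and v: "v \<in> M" for u v
  proof -
    have pol: "2 * inner a b = (norm (a + b))\<^sup>2 - (norm a)\<^sup>2 - (norm b)\<^sup>2" for a b :: "'c::real_inner"
      unfolding power2_norm_eq_inner by (simp add: inner_simps inner_commute)
    have "2 * inner (T u) (T v) = 2 * inner u v"
      unfolding pol bounded_opD(2)[OF b[OF u] u v, symmetric]
      using u v csubspaceD(2)[OF M u v] by (simp add: nrm)
    then show ?thesis by simp
  qed
  show ?thesis
    unfolding cinner_of_Re bounded_opD(3)[OF b[OF x] x, symmetric]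
    using inner x y csubspaceD(3)[OF M x] by simp
qed

text \<open>The notion \<open>dilation\<close> projects onto \<open>range J\<close>, and
  \<open>proj_cinner\<close> asks for a closed subspace.\<close>

lemma closed_csubspace_range_isometry:
  fixes J :: "'a::chilbert_space \<Rightarrow> 'b::chilbert_space"
  assumes J: "isometry_op UNIV K J"
  shows "closed_csubspace (range J)"
proof -
  have b: "bounded_op UNIV K J" and nrm: "\<And>u. norm (J u) = norm u"
    using J by (auto simp: isometry_op_def)
  have "csubspace (range J)"
  proof (rule csubspaceI)
    show "0 \<in> range J" using rangeI[of J 0] bounded_op_zero[OF csubspace_UNIV b] by simp
  qed (auto simp: bounded_opD(2,3)[OF b, symmetric])
  moreover have "closed (range J)"
    unfolding closed_sequential_limits
  proof (intro allI impI)
    fix f l assume f: "(\<forall>n. f n \<in> range J) \<and> f \<longlonglongrightarrow> l"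
    then have "\<forall>n. \<exists>x. f n = J x" by blast
    then obtain g where g: "\<forall>n. f n = J (g n)" by (rule choice[THEN exE])
    have "Cauchy f" using f by (auto intro: LIMSEQ_imp_Cauchy)
    moreover have "dist (g m) (g k) = dist (f m) (f k)" for m k
      using g nrm[of "g m - g k"] by (simp add: dist_norm bounded_op_diff[OF csubspace_UNIV b])
    ultimately have "Cauchy g" by (simp add: Cauchy_def)
    then obtain x where x: "g \<longlonglongrightarrow> x" by (auto simp: Cauchy_convergent_iff convergent_def)
    have "(\<lambda>n. J (g n)) \<longlonglongrightarrow> J x"
      by (rule bounded_op_tendsto[OF csubspace_UNIV b _ _ x]) simp_all
    moreover have "f = (\<lambda>n. J (g n))" using g by (simp add: fun_eq_iff)
    ultimately have "l = J x" using f LIMSEQ_unique by blast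
    then show "l \<in> range J" by simp
  qed
  ultimately show ?thesis by (simp add: closed_csubspace_def)
qed

lemma closure_cspan_subset:
  assumes "closed_csubspace Z" "G \<subseteq> Z"
  shows "closure (cspan G) \<subseteq> Z"
  using assms cvec.span_minimal[of G Z] by (simp add: closed_csubspace_def closure_minimal)

lemma in_closure_cspan: "x \<in> G \<Longrightarrow> x \<in> closure (cspan G)"
  by (rule subsetD[OF closure_subset cvec.span_base])

lemma closed_csubspace_closure_cspan: "closed_csubspace (closure (cspan G))"
  by (simp add: closed_csubspace_def csubspace_closure cvec.subspace_span)

lemma cinner_eqI_closure_cspan:
  assumes u: "u \<in> closure (cspan G)" and v: "v \<in> closure (cspan G)"
    and eq: "\<And>y. y \<in> G \<Longrightarrow> cinner u y = cinner v (y::'a::complex_inner)"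
  shows "u = v"
proof -
  have "closed_csubspace {y. cinner (u - v) y = 0}"
    unfolding closed_csubspace_def
  proof
    show "csubspace {y. cinner (u - v) y = 0}"
      by (rule csubspaceI) (auto simp: cinner_add_right cinner_scaleC_right cinner_zero_right)
    show "closed {y. cinner (u - v) y = 0}"
      unfolding closed_sequential_limits
    proof (intro allI impI)
      fix f l assume f: "(\<forall>n. f n \<in> {y. cinner (u - v) y = 0}) \<and> f \<longlonglongrightarrow> l"
      then have "(\<lambda>n. cinner (u - v) (f n)) \<longlonglongrightarrow> cinner (u - v) l"
        by (intro tendsto_cinner tendsto_const) simp
      then have "(\<lambda>n. 0) \<longlonglongrightarrow> cinner (u - v) l" using f by simp
      then show "l \<in> {y. cinner (u - v) y = 0}" by (simp add: LIMSEQ_const_iff)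
    qed
  qed
  then have "closure (cspan G) \<subseteq> {y. cinner (u - v) y = 0}"
    using eq by (intro closure_cspan_subset) (auto simp: cinner_diff_left)
  moreover have "u - v \<in> closure (cspan G)"
    using u v csubspaceD(4) closed_csubspace_closure_cspan[of G] unfolding closed_csubspace_def
    by (metis (no_types))
  ultimately have "cinner (u - v) (u - v) = 0" by auto
  then show ?thesis by (simp add: cinner_self)
qed

lemma bounded_op_eqI_closure_cspan:
  fixes A B :: "'a::complex_inner \<Rightarrow> 'b::complex_inner"
  assumes K: "K = closure (cspan G)" and A: "bounded_op K L A" and B: "bounded_op K L B"
    and eq: "\<And>x. x \<in> G \<Longrightarrow> A x = B x" and x: "x \<in> K"
  shows "A x = B x"
proof -
  have Ks: "csubspace K" and Kc: "closed K"
    using closed_csubspace_closure_cspan[of G] by (simp_all add: K closed_csubspace_def)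
  have "closed_csubspace {x \<in> K. A x = B x}"
    unfolding closed_csubspace_def
  proof
    show "csubspace {x \<in> K. A x = B x}"
      using csubspaceD[OF Ks] bounded_op_zero[OF Ks A] bounded_op_zero[OF Ks B]
      by (intro csubspaceI) (simp_all add: bounded_opD(2,3)[OF A] bounded_opD(2,3)[OF B])
    show "closed {x \<in> K. A x = B x}"
      unfolding closed_sequential_limits
    proof (intro allI impI)
      fix f l assume f: "(\<forall>n. f n \<in> {x \<in> K. A x = B x}) \<and> f \<longlonglongrightarrow> l"
      then have fK: "f n \<in> K" and fl: "f \<longlonglongrightarrow> l" and AB: "A (f n) = B (f n)" for n by auto
      have l: "l \<in> K" by (rule closed_sequentially[OF Kc fK fl])
      have "(\<lambda>n. A (f n)) \<longlonglongrightarrow> A l" "(\<lambda>n. B (f n)) \<longlonglongrightarrow> B l"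
        by (rule bounded_op_tendsto[OF Ks A fK l fl], rule bounded_op_tendsto[OF Ks B fK l fl])
      then have "A l = B l" unfolding AB by (rule LIMSEQ_unique)
      with l show "l \<in> {x \<in> K. A x = B x}" by simp
    qed
  qed
  then have "closure (cspan G) \<subseteq> {x \<in> K. A x = B x}"
    using eq by (intro closure_cspan_subset) (auto simp: K in_closure_cspan)
  with x show ?thesis unfolding K by blast
qed

section \<open>The unitary carried by two families with equal Gram matrices\<close>

text \<open>The graph of the linear map sending each \<open>x i\<close> to \<open>y i\<close>.\<close>

inductive span_graph :: "('i \<Rightarrow> 'a::complex_inner) \<Rightarrow> ('i \<Rightarrow> 'b::complex_inner) \<Rightarrow> 'a \<Rightarrow> 'b \<Rightarrow> bool"
  for x y where
  span_graph_zero: "span_graph x y 0 0"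
| span_graph_step: "span_graph x y a b \<Longrightarrow> span_graph x y (c *\<^sub>C x i + a) (c *\<^sub>C y i + b)"

text \<open>Working with a relation keeps the two families interchangeable; surjectivity of the
  unitary is totality with the families exchanged.\<close>

lemma span_graph_sym: "span_graph x y a b \<Longrightarrow> span_graph y x b a"
  by (induction rule: span_graph.induct) (auto intro: span_graph.intros)

lemma span_graph_add:
  "span_graph x y a b \<Longrightarrow> span_graph x y a' b' \<Longrightarrow> span_graph x y (a + a') (b + b')"
proof (induction rule: span_graph.induct)
  case (span_graph_step a b c i)
  then show ?case
    using span_graph.span_graph_step[of x y "a + a'" "b + b'" c i] by (simp add: add.assoc)
qed simp

lemma span_graph_scale: "span_graph x y a b \<Longrightarrow> span_graph x y (c *\<^sub>C a) (c *\<^sub>C b)"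
proof (induction rule: span_graph.induct)
  case span_graph_zero
  then show ?case by (simp add: scaleC_zero_right span_graph.span_graph_zero)
next
  case (span_graph_step a b d i)
  then show ?case
    using span_graph.span_graph_step[of x y "c *\<^sub>C a" "c *\<^sub>C b" "c * d" i]
    by (simp add: scaleC_add_right scaleC_scaleC)
qed

lemma span_graph_generator: "span_graph x y (x i) (y i)"
  using span_graph_step[OF span_graph_zero, of x y 1 i] by simp

lemma span_graph_domain: "span_graph x y a b \<Longrightarrow> a \<in> cspan (range x)"
proof (induction rule: span_graph.induct)
  case span_graph_zero
  show ?case by (rule cvec.span_zero)
next
  case (span_graph_step a b c i)
  from span_graph_step.IH show ?case
    by (rule cvec.span_add[OF cvec.span_scale[OF cvec.span_base[OF rangeI]]])
qed

lemma span_graph_total: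
  assumes "a \<in> cspan (range x)" shows "\<exists>b. span_graph x y a b"
  using assms
proof (induction rule: cvec.span_induct_alt)
  case base
  show ?case using span_graph_zero by blast
next
  case (step c z w)
  then obtain i b where "z = x i" "span_graph x y w b" by blast
  then show ?case using span_graph_step[of x y w b c i] by blast
qed

text \<open>The x i may be linearly dependent, so sending x i to y i need not define a map. Equality
  of the Gram matrices makes the relation isometric, and single-valuedness follows.\<close>

lemma span_graph_cinner:
  assumes gram: "\<And>i j. cinner (x i) (x j) = cinner (y i) (y j)"
    and "span_graph x y a b" "span_graph x y a' b'"
  shows "cinner a a' = cinner b b'"
proof -
  have gen: "cinner (x i) a' = cinner (y i) b'" for i
    using assms(3)
    by (induction rule: span_graph.induct)
      (simp_all add: cinner_zero_right cinner_add_right cinner_scaleC_right gram)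
  show ?thesis
    using assms(2)
    by (induction rule: span_graph.induct)
      (simp_all add: cinner_zero_left cinner_add_left cinner_scaleC_left gen)
qed

text \<open>The closure of the graph in the product space, described by sequences.\<close>

definition span_graph_lim ::
    "('i \<Rightarrow> 'a::complex_inner) \<Rightarrow> ('i \<Rightarrow> 'b::complex_inner) \<Rightarrow> 'a \<Rightarrow> 'b \<Rightarrow> bool" where
  "span_graph_lim x y k l \<longleftrightarrow>
     (\<exists>f g. (\<forall>n. span_graph x y (f n) (g n)) \<and> f \<longlonglongrightarrow> k \<and> g \<longlonglongrightarrow> l)"

lemma span_graph_limI:
  "(\<And>n. span_graph x y (f n) (g n)) \<Longrightarrow> f \<longlonglongrightarrow> k \<Longrightarrow> g \<longlonglongrightarrow> l \<Longrightarrow> span_graph_lim x y k l"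
  unfolding span_graph_lim_def by blast

lemma span_graph_lim_sym: "span_graph_lim x y k l \<Longrightarrow> span_graph_lim y x l k"
  unfolding span_graph_lim_def using span_graph_sym[of x y] by blast

lemma span_graph_lim_add:
  assumes "span_graph_lim x y k l" "span_graph_lim x y k' l'"
  shows "span_graph_lim x y (k + k') (l + l')"
proof -
  obtain f g where fg: "\<forall>n. span_graph x y (f n) (g n)" "f \<longlonglongrightarrow> k" "g \<longlonglongrightarrow> l"
    using assms(1) unfolding span_graph_lim_def by blast
  obtain f' g' where fg': "\<forall>n. span_graph x y (f' n) (g' n)" "f' \<longlonglongrightarrow> k'" "g' \<longlonglongrightarrow> l'"
    using assms(2) unfolding span_graph_lim_def by blast
  show ?thesis
    by (rule span_graph_limI[OF span_graph_add[OF fg(1)[THEN spec] fg'(1)[THEN spec]]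
          tendsto_add[OF fg(2) fg'(2)] tendsto_add[OF fg(3) fg'(3)]])
qed

lemma span_graph_lim_scale:
  assumes "span_graph_lim x y k l"
  shows "span_graph_lim x y (c *\<^sub>C k) (c *\<^sub>C l)"
proof -
  obtain f g where fg: "\<forall>n. span_graph x y (f n) (g n)" "f \<longlonglongrightarrow> k" "g \<longlonglongrightarrow> l"
    using assms(1) unfolding span_graph_lim_def by blast
  show ?thesis
    by (rule span_graph_limI[OF span_graph_scale[OF fg(1)[THEN spec]] tendsto_scaleC[OF fg(2)]
          tendsto_scaleC[OF fg(3)]])
qed

lemma span_graph_lim_domain:
  assumes "span_graph_lim x y k l" shows "k \<in> closure (cspan (range x))"
proof -
  obtain f g where fg: "\<forall>n. span_graph x y (f n) (g n)" "f \<longlonglongrightarrow> k" "g \<longlonglongrightarrow> l"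
    using assms(1) unfolding span_graph_lim_def by blast
  then show ?thesis
    unfolding closure_sequential using span_graph_domain[OF fg(1)[THEN spec]]
    by (intro exI[of _ f]) simp
qed

context
  fixes x :: "'i \<Rightarrow> 'a::chilbert_space" and y :: "'i \<Rightarrow> 'b::chilbert_space"
  assumes gram: "\<And>i j. cinner (x i) (x j) = cinner (y i) (y j)"
begin

lemma span_graph_norm:
  assumes "span_graph x y a b" shows "norm a = norm b"
proof -
  have "complex_of_real ((norm a)\<^sup>2) = complex_of_real ((norm b)\<^sup>2)"
    using span_graph_cinner[OF gram assms assms] by (simp only: cinner_self)
  then have "(norm a)\<^sup>2 = (norm b)\<^sup>2" by (rule of_real_eq_iff[THEN iffD1])
  then show ?thesis by (simp add: power2_eq_iff_nonneg)
qed

lemma span_graph_lim_norm: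
  assumes "span_graph_lim x y k l" shows "norm k = norm l"
proof -
  obtain f g where fg: "\<forall>n. span_graph x y (f n) (g n)" "f \<longlonglongrightarrow> k" "g \<longlonglongrightarrow> l"
    using assms(1) unfolding span_graph_lim_def by blast
  have "(\<lambda>n. norm (f n)) \<longlonglongrightarrow> norm k" "(\<lambda>n. norm (g n)) \<longlonglongrightarrow> norm l"
    by (intro tendsto_norm fg)+
  then show ?thesis
    unfolding span_graph_norm[OF fg(1)[THEN spec]] by (rule LIMSEQ_unique)
qed

lemma span_graph_lim_unique:
  assumes "span_graph_lim x y k l" "span_graph_lim x y k l'"
  shows "l = l'"
proof -
  \<comment> \<open>The difference of the two pairs is (0, l - l'), and related vectors have equal
    norms.\<close>
  have "norm (k + (-1) *\<^sub>C k) = norm (l + (-1) *\<^sub>C l')"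
    by (rule span_graph_lim_norm[OF span_graph_lim_add[OF assms(1) span_graph_lim_scale[OF assms(2)]]])
  then show ?thesis by (simp only: scaleC_minus_one) simp
qed

lemma span_graph_lim_total:
  assumes "k \<in> closure (cspan (range x))"
  shows "\<exists>l. span_graph_lim x y k l"
proof -
  obtain f where f: "\<forall>n. f n \<in> cspan (range x)" "f \<longlonglongrightarrow> k"
    using assms unfolding closure_sequential by blast
  have "\<forall>n. \<exists>b. span_graph x y (f n) b"
    using f(1) span_graph_total[of _ x y] by simp
  then obtain g where g: "\<forall>n. span_graph x y (f n) (g n)" by (rule choice[THEN exE])
  have "dist (g m) (g n) = dist (f m) (f n)" for m n
  proof -
    have "span_graph x y (f m + (-1) *\<^sub>C f n) (g m + (-1) *\<^sub>C g n)"
      using g by (intro span_graph_add span_graph_scale) auto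
    from span_graph_norm[OF this] show ?thesis
      by (simp only: scaleC_minus_one dist_norm) simp
  qed
  moreover have "Cauchy f" using f(2) by (rule LIMSEQ_imp_Cauchy)
  ultimately have "Cauchy g" by (simp add: Cauchy_def)
  then obtain l where "g \<longlonglongrightarrow> l" by (auto simp: Cauchy_convergent_iff convergent_def)
  then show ?thesis
    using f(2) g unfolding span_graph_lim_def by blast
qed

end

lemma unitary_from_gram:
  fixes x :: "'i \<Rightarrow> 'a::chilbert_space" and y :: "'i \<Rightarrow> 'b::chilbert_space"
  assumes gram: "\<And>i j. cinner (x i) (x j) = cinner (y i) (y j)"
  shows "\<exists>U. unitary_op (closure (cspan (range x))) (closure (cspan (range y))) U
    \<and> (\<forall>i. U (x i) = y i)"
proof -
  let ?K = "closure (cspan (range x))" and ?L = "closure (cspan (range y))"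
  define U where "U k = (SOME l. span_graph_lim x y k l)" for k
  have U: "span_graph_lim x y k (U k)" if "k \<in> ?K" for k
    unfolding U_def by (rule someI_ex[OF span_graph_lim_total[OF gram that]])
  have U_eq: "U k = l" if "span_graph_lim x y k l" for k l
    by (rule span_graph_lim_unique[OF gram U[OF span_graph_lim_domain[OF that]] that])
  have "bounded_op ?K ?L U"
    unfolding bounded_op_def
  proof (intro conjI ballI allI)
    show "U k \<in> ?L" if "k \<in> ?K" for k
      by (rule span_graph_lim_domain[OF span_graph_lim_sym[OF U[OF that]]])
    show "U (k + k') = U k + U k'" if "k \<in> ?K" "k' \<in> ?K" for k k'
      by (rule U_eq[OF span_graph_lim_add[OF U[OF that(1)] U[OF that(2)]]])
    show "U (c *\<^sub>C k) = c *\<^sub>C U k" if "k \<in> ?K" for c k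
      by (rule U_eq[OF span_graph_lim_scale[OF U[OF that]]])
    show "\<exists>B. \<forall>k\<in>?K. norm (U k) \<le> B * norm k"
      using span_graph_lim_norm[OF gram U] by (intro exI[of _ 1]) simp
  qed
  then have "isometry_op ?K ?L U"
    using span_graph_lim_norm[OF gram U] by (simp add: isometry_op_def)
  moreover have "U ` ?K = ?L"
  proof
    show "U ` ?K \<subseteq> ?L" using bounded_opD(1)[OF \<open>bounded_op ?K ?L U\<close>] by blast
    show "?L \<subseteq> U ` ?K"
    proof
      fix l assume "l \<in> ?L"
      \<comment> \<open>Surjectivity: the Gram hypothesis is symmetric in x and y, so totality holds
        for the reversed relation too.\<close>
      then obtain k where "span_graph_lim y x l k"
        using span_graph_lim_total[of y x, OF gram[symmetric]] by blast
      then have kl: "span_graph_lim x y k l" by (rule span_graph_lim_sym)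
      show "l \<in> U ` ?K"
        using U_eq[OF kl] span_graph_lim_domain[OF kl] by blast
    qed
  qed
  moreover have "U (x i) = y i" for i
    by (rule U_eq, rule span_graph_limI[of x y "\<lambda>_. x i" "\<lambda>_. y i"])
      (simp_all add: span_graph_generator)
  ultimately show ?thesis unfolding unitary_op_def by blast
qed

subsection \<open>Agler-Young isometric dilations\<close>

context
  fixes n :: nat and S :: "nat \<Rightarrow> 'a::chilbert_space \<Rightarrow> 'a"
    and K :: "'b::chilbert_space set" and J :: "'a \<Rightarrow> 'b" and W :: "nat \<Rightarrow> 'b \<Rightarrow> 'b"
  assumes n: "n \<ge> 1" and dil: "AY_isometric_dilation n K J W S"
begin

lemma
  shows dil_closed: "closed_csubspace K" and dil_csubspace: "csubspace K"
    and dil_J: "isometry_op UNIV K J" and dil_last: "isometry_op K K (W n)"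
    and dil_bounded: "i \<in> {1..n} \<Longrightarrow> bounded_op K K (W i)"
    and dil_J_in: "J h \<in> K"
proof -
  show K: "closed_csubspace K" and J: "isometry_op UNIV K J" and "isometry_op K K (W n)"
    and "i \<in> {1..n} \<Longrightarrow> bounded_op K K (W i)"
    using dil by (simp_all add: AY_isometric_dilation_def dilation_def AY_isometry_def)
  show "csubspace K" using K by (simp add: closed_csubspace_def)
  have "bounded_op UNIV K J" using J by (simp add: isometry_op_def)
  from bounded_opD(1)[OF this UNIV_I] show "J h \<in> K" .
qed

lemma dil_last_bounded: "bounded_op K K (W n)"
  using dil_last by (simp add: isometry_op_def)

lemma dil_powers_in: "(W n ^^ m) (J h) \<in> K"
  by (rule funpow_in[OF dil_last_bounded dil_J_in])

lemma dil_cinner_J: "cinner (J h) (J h') = cinner h h'"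
  by (rule isometry_cinner[OF csubspace_UNIV dil_J]) simp_all

text \<open>The dilation property in weak form: pairing with vectors of \<open>range J\<close>
  absorbs the projection.\<close>

lemma dil_cinner_word:
  assumes "w \<noteq> []" "set w \<subseteq> {1..n}"
  shows "cinner (foldr W w (J h)) (J h') = cinner (foldr S w h) h'"
proof -
  have "J (foldr S w h) = proj (range J) (foldr W w (J h))"
    using dil assms by (simp add: AY_isometric_dilation_def dilation_def)
  then have "cinner (J (foldr S w h)) (J h') = cinner (foldr W w (J h)) (J h')"
    using proj_cinner(2)[OF closed_csubspace_range_isometry[OF dil_J] rangeI, of "foldr W w (J h)" h']
    by simp
  then show ?thesis by (simp add: dil_cinner_J)
qed

lemma dil_cinner_power: "cinner ((W n ^^ j) (J h)) (J h') = cinner ((S n ^^ j) h) h'"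
\<comment> \<open>\<open>dilation\<close> speaks of nonempty words only; for j = 0 the claim is that
  J is isometric.\<close>
proof (cases "j = 0")
  case False
  then show ?thesis
    using dil_cinner_word[of "replicate j n" h h'] n by (simp add: foldr_replicate)
qed (simp add: dil_cinner_J)

lemma dil_cinner_mixed:
  assumes "i \<in> {1..n}"
  shows "cinner (W i ((W n ^^ j) (J h))) (J h') = cinner (S i ((S n ^^ j) h)) h'"
  using dil_cinner_word[of "i # replicate j n" h h'] n assms
  by (simp add: foldr_replicate set_replicate_conv_if)

lemma dil_shift_last:
  assumes "a \<in> K" "b \<in> K"
  shows "cinner ((W n ^^ m) a) ((W n ^^ m) b) = cinner a b"
proof (induction m)
  case (Suc m)
  then show ?case
    using isometry_cinner[OF dil_csubspace dil_last] funpow_in[OF dil_last_bounded] assms by simp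
qed simp

lemma dil_flip:
  assumes "i \<in> {1..<n}" "a \<in> K" "b \<in> K"
  shows "cinner (W i a) b = cinner (W n a) (W (n - i) b)"
proof -
  have "W i a = adj K (W (n - i)) (W n a)"
    using dil assms by (simp add: AY_isometric_dilation_def AY_isometry_def)
  moreover have "n - i \<in> {1..n}" using assms by auto
  ultimately show ?thesis
    using cinner_adj_left[OF dil_closed dil_bounded assms(3)] by simp
qed

text \<open>Applying \<open>dil_flip\<close> for \<open>i\<close> and then for \<open>n - i\<close> shows that \<open>W i\<close> is a Toeplitz operator
  with respect to the isometry \<open>W n\<close>.\<close>

lemma dil_toeplitz_step:
  assumes i: "i \<in> {1..<n}" and a: "a \<in> K" and b: "b \<in> K"
  shows "cinner (W i (W n a)) (W n b) = cinner (W i a) b"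
proof -
  have i': "n - i \<in> {1..<n}" "n - (n - i) = i" using i by auto
  have "cinner (W n b) (W i (W n a)) = cinner (W (n - i) b) (W n a)"
    using dil_flip[OF i'(1) b, of "W n a"] bounded_opD(1)[OF dil_last_bounded a] i'(2) by simp
  then have "cinner (W i (W n a)) (W n b) = cinner (W n a) (W (n - i) b)"
    by (metis cinner_commute)
  then show ?thesis using dil_flip[OF i a b] by simp
qed

lemma dil_toeplitz:
  assumes "i \<in> {1..<n}" "a \<in> K" "b \<in> K"
  shows "cinner (W i ((W n ^^ m) a)) ((W n ^^ m) b) = cinner (W i a) b"
proof (induction m)
  case (Suc m)
  have "(W n ^^ m) a \<in> K" "(W n ^^ m) b \<in> K"
    using assms(2,3) funpow_in[OF dil_last_bounded] by blast+
  from dil_toeplitz_step[OF assms(1) this] show ?case by (simp add: Suc.IH)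
qed simp

text \<open>The smaller of the two powers cancels because W n is isometric, and what remains is a
  compression to \<open>range J\<close>. The value therefore depends on S n alone.\<close>

lemma dil_gram_last:
  "cinner ((W n ^^ j) (J h)) ((W n ^^ m) (J h')) =
    (if m \<le> j then cinner ((S n ^^ (j - m)) h) h' else cinner h ((S n ^^ (m - j)) h'))"
proof (cases "m \<le> j")
  case True
  have "(W n ^^ j) (J h) = (W n ^^ m) ((W n ^^ (j - m)) (J h))"
    using True by (simp flip: funpow_add[THEN fun_cong, unfolded comp_apply])
  then show ?thesis
    using dil_shift_last[OF dil_powers_in dil_J_in] dil_cinner_power True by simp
next
  case False
  then have "(W n ^^ m) (J h') = (W n ^^ j) ((W n ^^ (m - j)) (J h'))"
    by (simp flip: funpow_add[THEN fun_cong, unfolded comp_apply])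
  then have "cinner ((W n ^^ j) (J h)) ((W n ^^ m) (J h'))
      = cnj (cinner ((W n ^^ (m - j)) (J h')) (J h))"
    using dil_shift_last[OF dil_J_in dil_powers_in] cinner_commute by metis
  also have "\<dots> = cinner h ((S n ^^ (m - j)) h')"
    unfolding dil_cinner_power by (rule cinner_commute[symmetric])
  finally show ?thesis using False by simp
qed

text \<open>For m at most j the Toeplitz property cancels m powers and the dilation property
  applies. Otherwise a positive power of W n survives on the right, next to no W i there, so no word
  in the tuple can be compressed directly. A flip moves the middle operator to the right as W (n -
  i), and a Toeplitz step for n - i then removes one W n from each side.\<close>

lemma dil_gram:
  assumes i: "i \<in> {1..<n}"
  shows "cinner (W i ((W n ^^ j) (J h))) ((W n ^^ m) (J h')) =
    (if m \<le> j then cinner (S i ((S n ^^ (j - m)) h)) h'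
     else cinner h (S (n - i) ((S n ^^ (m - Suc j)) h')))"
proof (cases "m \<le> j")
  case True
  have "(W n ^^ j) (J h) = (W n ^^ m) ((W n ^^ (j - m)) (J h))"
    using True by (simp flip: funpow_add[THEN fun_cong, unfolded comp_apply])
  then show ?thesis
    using dil_toeplitz[OF i dil_powers_in dil_J_in] dil_cinner_mixed[of i] i True by simp
next
  case False
  \<comment> \<open>One less than the surplus m - j, because the flip followed by the Toeplitz step
    uses up one power.\<close>
  define k where "k = m - Suc j"
  have m: "m = j + Suc k" using False by (simp add: k_def)
  have i': "n - i \<in> {1..<n}" using i by auto
  have "(W n ^^ m) (J h') = (W n ^^ j) ((W n ^^ Suc k) (J h'))"
    by (simp only: m funpow_add comp_apply)
  then have "cinner (W i ((W n ^^ j) (J h))) ((W n ^^ m) (J h'))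
      = cinner (W i (J h)) ((W n ^^ Suc k) (J h'))"
    by (simp only: dil_toeplitz[OF i dil_J_in dil_powers_in])
  also have "\<dots> = cinner (W n (J h)) (W (n - i) (W n ((W n ^^ k) (J h'))))"
    using dil_flip[OF i dil_J_in dil_powers_in[of "Suc k"]] by simp
  also have "\<dots> = cnj (cinner (W (n - i) (W n ((W n ^^ k) (J h')))) (W n (J h)))"
    by (rule cinner_commute)
  also have "\<dots> = cnj (cinner (W (n - i) ((W n ^^ k) (J h'))) (J h))"
    by (simp only: dil_toeplitz_step[OF i' dil_powers_in dil_J_in])
  also have "\<dots> = cnj (cinner (S (n - i) ((S n ^^ k) h')) h)"
    using dil_cinner_mixed[of "n - i" k h' h] i' by simp
  also have "\<dots> = cinner h (S (n - i) ((S n ^^ k) h'))"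
    by (rule cinner_commute[symmetric])
  finally show ?thesis using False by (simp add: k_def)
qed

end

text \<open>The Gram matrices of the generators agree, so a unitary matches them. It intertwines the
  last entries because those map generators to generators. For i < n, \<open>U (W i g)\<close> and
  \<open>V i (U g)\<close> both lie in L and, by \<open>dil_gram\<close>, have the same inner
  products with the generators of L.\<close>

lemma minimal_dilation_unique:
  fixes K :: "'b::chilbert_space set" and L :: "'c::chilbert_space set"
    and S :: "nat \<Rightarrow> 'a::chilbert_space \<Rightarrow> 'a"
  assumes n: "n \<ge> 1"
    and W: "AY_isometric_dilation n K J W S" and V: "AY_isometric_dilation n L I V S"
    and K: "K = closure (cspan {(W n ^^ m) (J h) |m h. True})"
    and L: "L = closure (cspan {(V n ^^ m) (I h) |m h. True})"
  shows "\<exists>U. unitary_op K L U \<and> (\<forall>m h. U ((W n ^^ m) (J h)) = (V n ^^ m) (I h))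
    \<and> (\<forall>i\<in>{1..n}. \<forall>x\<in>K. U (W i x) = V i (U x))"
proof -
  define x where "x = (\<lambda>(m, h). (W n ^^ m) (J h))"
  define y where "y = (\<lambda>(m, h). (V n ^^ m) (I h))"
  have rx: "{(W n ^^ m) (J h) |m h. True} = range x" and ry: "{(V n ^^ m) (I h) |m h. True} = range y"
    by (auto simp: x_def y_def)
  have "cinner (x i) (x j) = cinner (y i) (y j)" for i j
    by (cases i; cases j) (simp add: x_def y_def dil_gram_last[OF n W] dil_gram_last[OF n V])
  from unitary_from_gram[of x y, OF this]
  obtain U where U: "unitary_op K L U" and Uxy: "\<forall>i. U (x i) = y i"
    unfolding K L rx ry by blast
  have Ux: "U ((W n ^^ m) (J h)) = (V n ^^ m) (I h)" for m h
    using Uxy[THEN spec, of "(m, h)"] by (simp add: x_def y_def)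
  have iso: "isometry_op K L U" and bU: "bounded_op K L U"
    using U by (simp_all add: unitary_op_def isometry_op_def)
  have "U (W i z) = V i (U z)" if i: "i \<in> {1..n}" and z: "z \<in> K" for i z
  proof (rule bounded_op_eqI_closure_cspan[OF K _ _ _ z])
    note bW = dil_bounded[OF n W i] and bV = dil_bounded[OF n V i]
    show "bounded_op K L (\<lambda>z. U (W i z))" by (rule bounded_op_compose[OF bU bW])
    show "bounded_op K L (\<lambda>z. V i (U z))" by (rule bounded_op_compose[OF bV bU])
    fix g assume "g \<in> {(W n ^^ m) (J h) |m h. True}"
    then obtain j h where g: "g = (W n ^^ j) (J h)" by blast
    show "U (W i g) = V i (U g)"
    proof (cases "i = n")
      case True
      then show ?thesis using Ux[of "Suc j" h] Ux[of j h] by (simp add: g)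
    next
      case False
      then have i': "i \<in> {1..<n}" using i by auto
      have gK: "g \<in> K" unfolding g by (rule dil_powers_in[OF n W])
      have WK: "W i g \<in> K" by (rule bounded_opD(1)[OF bW gK])
      have "U (W i g) \<in> L" by (rule bounded_opD(1)[OF bU WK])
      moreover have "V i (U g) \<in> L" by (intro bounded_opD(1)[OF bV] bounded_opD(1)[OF bU] gK)
      moreover have "cinner (U (W i g)) v = cinner (V i (U g)) v"
        if vG: "v \<in> {(V n ^^ m) (I h) |m h. True}" for v
      proof -
        obtain m h' where v: "v = (V n ^^ m) (I h')" using vG by blast
        have "cinner (U (W i g)) v = cinner (W i g) ((W n ^^ m) (J h'))"
          unfolding v Ux[symmetric]
          by (rule isometry_cinner[OF dil_csubspace[OF n W] iso WK dil_powers_in[OF n W]])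
        then show ?thesis
          unfolding g Ux v by (simp add: dil_gram[OF n W i'] dil_gram[OF n V i'])
      qed
      ultimately show ?thesis
        unfolding L by (rule cinner_eqI_closure_cspan)
    qed
  qed
  with U Ux show ?thesis by blast
qed

text \<open>Two functions representing the same operator may differ off K, so their powers are
  compared on K only.\<close>

lemma funpow_cong_on:
  assumes "bounded_op K K A" "\<And>f. f \<in> K \<Longrightarrow> B f = A f" "x \<in> K"
  shows "(B ^^ m) x = (A ^^ m) x"
  by (induction m) (simp_all add: assms funpow_in[OF assms(1)])

theorem theorem2:
  fixes n :: nat
    and S X :: "nat \<Rightarrow> 'a::chilbert_space \<Rightarrow> 'a"
  assumes "n \<ge> 2"
    and "AY_tuple n S"
    and "fundamental_tuple n S X"
  shows "(coinvariant n (K0 (S n)) (range embed0) (V_tuple n S X) \<and>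
          AY_isometric_dilation n (K0 (S n)) embed0 (V_tuple n S X) S)
       \<and> (\<forall>W :: nat \<Rightarrow> 'a ell2 \<Rightarrow> 'a ell2.
            AY_isometric_dilation n (K0 (S n)) embed0 W S \<and>
            (\<forall>f\<in>K0 (S n). W n f = V_last (S n) f) \<and>
            coinvariant n (K0 (S n)) (range embed0) W
            \<longrightarrow> (\<forall>i\<in>{1..<n}. \<forall>f\<in>K0 (S n). W i f = V_fund n S X i f))
       \<and> (\<forall>(K :: 'b::chilbert_space set) (J :: 'a \<Rightarrow> 'b) (W :: nat \<Rightarrow> 'b \<Rightarrow> 'b).
            AY_isometric_dilation n K J W S \<and>
            minimal_isometric_dilation K J (W n) (S n)
            \<longrightarrow> unitarily_equivalent n K W (K0 (S n)) (V_tuple n S X))"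
proof -
  let ?K = "K0 (S n)" and ?V = "V_tuple n S X"
  have n: "n \<ge> 1" using assms(1) by simp
  have contr: "contraction_op (S n)" by (rule contraction_Sn[OF assms(2,3)])
  note dilV = AY_isometric_dilation_V_tuple[OF assms(2,3)]
  have Vn: "?V n = V_last (S n)" by (simp add: V_tuple_def)
  have K: "?K = closure (cspan {(?V n ^^ m) (embed0 h) |m h. True})"
    unfolding Vn by (rule K0_eq_closure_span[OF contr])
  have "W i f = V_fund n S X i f"
    if W: "AY_isometric_dilation n ?K embed0 W S" and last: "\<forall>f\<in>?K. W n f = V_last (S n) f"
      and i: "i \<in> {1..<n}" and f: "f \<in> ?K" for W :: "nat \<Rightarrow> 'a ell2 \<Rightarrow> 'a ell2" and i f
  proof -
    have pow: "(W n ^^ m) (embed0 h) = (?V n ^^ m) (embed0 h)" for m h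
      unfolding Vn using last
      by (intro funpow_cong_on[OF bounded_op_V_last[OF contr]] embed0_in_K0 contr) auto
    have i': "i \<in> {1..n}" and V: "?V i = V_fund n S X i" using i by (auto simp: V_tuple_def)
    \<comment> \<open>The last entries have equal powers on embedded vectors, so
      \<open>K[folded pow]\<close> states the minimality of W n.\<close>
    obtain U where U: "unitary_op ?K ?K U" "\<forall>m h. U ((W n ^^ m) (embed0 h)) = (?V n ^^ m) (embed0 h)"
      "\<forall>i\<in>{1..n}. \<forall>x\<in>?K. U (W i x) = ?V i (U x)"
      using minimal_dilation_unique[OF n W dilV K[folded pow] K] by blast
    \<comment> \<open>U sends each generator to itself, hence is the identity on the closed span,
      and the intertwining relation becomes equality.\<close>
    have "U z = z" if "z \<in> ?K" for z
    proof (rule bounded_op_eqI_closure_cspan[OF K _ _ _ that])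
      show "bounded_op ?K ?K U" using U(1) by (simp add: unitary_op_def isometry_op_def)
      show "bounded_op ?K ?K (\<lambda>z. z)" by (auto simp: bounded_op_def intro!: exI[of _ 1])
      show "U z = z" if "z \<in> {(?V n ^^ m) (embed0 h) |m h. True}" for z
        using that U(2) pow by auto
    qed
    then have "W i f = ?V i f"
      using U(3)[rule_format, OF i' f] f bounded_opD(1)[OF dil_bounded[OF n W i'] f] by simp
    then show ?thesis unfolding V .
  qed
  moreover have "unitarily_equivalent n K W ?K ?V"
    if W: "AY_isometric_dilation n K J W S" and min: "minimal_isometric_dilation K J (W n) (S n)"
    for K :: "'b set" and J :: "'a \<Rightarrow> 'b" and W :: "nat \<Rightarrow> 'b \<Rightarrow> 'b"
  proof -
    have KW: "K = closure (cspan {(W n ^^ m) (J h) |m h. True})"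
      using min by (simp add: minimal_isometric_dilation_def)
    show ?thesis
      using minimal_dilation_unique[OF n W dilV KW K] unfolding unitarily_equivalent_def by blast
  qed
  ultimately show ?thesis
    using coinvariant_V_tuple[OF assms(2,3)] dilV by blast
qed

end
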